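(* Let $\mathfrak g$ be a real simple Lie algebra of non-compact type with Iwasawa decomposition $\mathfrak g=\mathfrak k+\mathfrak a+\mathfrak n$. Then $\mathfrak g$ is $O_{min}$-split if and only if $$\dim\,\mathrm{Cent}\,\mathfrak n=1 .$$
   Context: Let $\mathfrak g=\mathfrak k+\mathfrak p$ be a Cartan decomposition, $\mathfrak a\subset\mathfrak p$ maximal abelian, $\Delta\subset\mathfrak a^*$ the restricted roots with root spaces $\mathfrak g_\beta$, $\Delta_+$ a positive system, $\mathfrak n=\sum_{\beta\in\Delta_+}\mathfrak g_\beta$, and $\psi\in\Delta_+$ the highest restricted root. $\mathrm{Cent}\,\mathfrak n$ is the center of $\mathfrak n$ (real dimension is meant). Let $x_\psi\in\mathfrak a$ be the Killing-orthogonal vector to $\ker\psi$ with $\psi(x_\psi)=2$, let $(\cdot,\cdot)$ be the positive multiple of the Killing form with $(x_\psi,x_\psi)=2$, let $\theta$ be the Cartan involution, and let $e\in\mathfrak g_\psi$ satisfy $(e,\theta e)=-1$. Definition: $\mathfrak g$ is $O_{min}$-split if $\mathfrak g_{\mathbb C}$ is a simple complex Lie algebra and $e\in O_{min}$, where $O_{min}$ is the minimal (non-zero) nilpotent adjoint orbit in $\mathfrak g_{\mathbb C}$. This depends only on $\mathfrak g$, not on the choice of $e$. *)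

theory Defs
  imports "HOL-Analysis.Analysis"
begin

section \<open>Lie algebras over a field\<close>

locale lie_algebra = vector_space scl
  for scl :: "'k::field \<Rightarrow> 'v::ab_group_add \<Rightarrow> 'v" +
  fixes br :: "'v \<Rightarrow> 'v \<Rightarrow> 'v"
  assumes br_add_left: "br (x + y) z = br x z + br y z"
    and br_add_right: "br x (y + z) = br x y + br x z"
    and br_scale_left: "br (scl r x) y = scl r (br x y)"
    and br_scale_right: "br x (scl r y) = scl r (br x y)"
    and br_self: "br x x = 0"
    and jacobi: "br x (br y z) + br y (br z x) + br z (br x y) = 0"

definition lie_ideal ::
  "('k::field \<Rightarrow> 'v::ab_group_add \<Rightarrow> 'v) \<Rightarrow> ('v \<Rightarrow> 'v \<Rightarrow> 'v) \<Rightarrow> 'v set \<Rightarrow> bool" where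
  "lie_ideal scl br I \<longleftrightarrow> module.subspace scl I \<and> (\<forall>x. \<forall>y\<in>I. br x y \<in> I)"

locale simple_lie_algebra = lie_algebra scl br
  for scl :: "'k::field \<Rightarrow> 'v::ab_group_add \<Rightarrow> 'v" and br :: "'v \<Rightarrow> 'v \<Rightarrow> 'v" +
  assumes nonabelian: "\<exists>x y. br x y \<noteq> 0"
    and ideals_trivial: "lie_ideal scl br I \<Longrightarrow> I = {0} \<or> I = UNIV"


section \<open>Nilpotent adjoint orbits\<close>

definition ad_nilpotent :: "('v::zero \<Rightarrow> 'v \<Rightarrow> 'v) \<Rightarrow> 'v \<Rightarrow> bool" where
  "ad_nilpotent br x \<longleftrightarrow> (\<exists>n. \<forall>y. (br x ^^ n) y = 0)"

definition exp_ad :: "('v::real_normed_vector \<Rightarrow> 'v \<Rightarrow> 'v) \<Rightarrow> 'v \<Rightarrow> 'v \<Rightarrow> 'v" where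
  "exp_ad br x y = (\<Sum>n. (1 / fact n) *\<^sub>R (br x ^^ n) y)"

text \<open>The group of inner automorphisms. Closure under inverses is automatic, the inverse of
  \<open>exp (ad x)\<close> being \<open>exp (ad (- x))\<close>.\<close>

inductive_set adjoint_group :: "('v::real_normed_vector \<Rightarrow> 'v \<Rightarrow> 'v) \<Rightarrow> ('v \<Rightarrow> 'v) set"
  for br where
  "id \<in> adjoint_group br"
| "g \<in> adjoint_group br \<Longrightarrow> exp_ad br x \<circ> g \<in> adjoint_group br"

definition adjoint_orbit :: "('v::real_normed_vector \<Rightarrow> 'v \<Rightarrow> 'v) \<Rightarrow> 'v \<Rightarrow> 'v set" where
  "adjoint_orbit br x = (\<lambda>g. g x) ` adjoint_group br"

definition nonzero_nilpotent_orbits :: "('v::real_normed_vector \<Rightarrow> 'v \<Rightarrow> 'v) \<Rightarrow> 'v set set" where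
  "nonzero_nilpotent_orbits br = {adjoint_orbit br x | x. x \<noteq> 0 \<and> ad_nilpotent br x}"

text \<open>Minimality refers to the closure order on orbits. For a simple complex Lie algebra the
  minimal element is unique.\<close>

definition minimal_nilpotent_orbit ::
  "('v::real_normed_vector \<Rightarrow> 'v \<Rightarrow> 'v) \<Rightarrow> 'v set \<Rightarrow> bool" where
  "minimal_nilpotent_orbit br \<Omega> \<longleftrightarrow>
     \<Omega> \<in> nonzero_nilpotent_orbits br \<and>
     (\<forall>\<Omega>'\<in>nonzero_nilpotent_orbits br. \<Omega>' \<subseteq> closure \<Omega> \<longrightarrow> \<Omega>' = \<Omega>)"

definition O_min :: "('v::real_normed_vector \<Rightarrow> 'v \<Rightarrow> 'v) \<Rightarrow> 'v set" where
  "O_min br = (THE \<Omega>. minimal_nilpotent_orbit br \<Omega>)"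


section \<open>Complexification\<close>

text \<open>The pair \<open>(x, y)\<close> stands for \<open>x + i y\<close>.\<close>

definition cscale :: "complex \<Rightarrow> 'g::real_vector \<times> 'g \<Rightarrow> 'g \<times> 'g" where
  "cscale c z = (Re c *\<^sub>R fst z - Im c *\<^sub>R snd z, Re c *\<^sub>R snd z + Im c *\<^sub>R fst z)"

definition complexify :: "('g::real_vector \<Rightarrow> 'g \<Rightarrow> 'g) \<Rightarrow> 'g \<times> 'g \<Rightarrow> 'g \<times> 'g \<Rightarrow> 'g \<times> 'g" where
  "complexify br z w =
     (br (fst z) (fst w) - br (snd z) (snd w), br (fst z) (snd w) + br (snd z) (fst w))"

lemma lie_algebra_complexify:
  fixes br :: "'g::real_vector \<Rightarrow> 'g \<Rightarrow> 'g"
  assumes "lie_algebra (*\<^sub>R) br"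
  shows "lie_algebra cscale (complexify br)"
proof -
  interpret L: lie_algebra "(*\<^sub>R)" br by (fact assms)
  have skew: "br y x = - br x y" for x y
    using L.br_self[of "x + y"] L.br_self[of x] L.br_self[of y]
    by (simp add: L.br_add_left L.br_add_right eq_neg_iff_add_eq_0 add.commute)
  have diffl: "br (x - y) z = br x z - br y z" for x y z
    using L.br_add_left[of "x - y" y z] by simp
  have diffr: "br z (x - y) = br z x - br z y" for x y z
    using L.br_add_right[of z "x - y" y] by simp
  have jac: "br x (br y z) = - br y (br z x) - br z (br x y)" for x y z
    using L.jacobi[of x y z] by (simp add: algebra_simps eq_neg_iff_add_eq_0)
  show ?thesis
  proof
    fix x y z :: "'g \<times> 'g"
    show "complexify br x (complexify br y z) + complexify br y (complexify br z x)
        + complexify br z (complexify br x y) = 0"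
      by (simp add: complexify_def prod_eq_iff L.br_add_left L.br_add_right diffl diffr
          jac[of "fst x"] jac[of "snd x"])
  qed (auto simp: complexify_def cscale_def prod_eq_iff algebra_simps L.br_add_left L.br_add_right
      L.br_scale_left L.br_scale_right diffl diffr L.br_self skew[of "fst x" "snd x" for x])
qed


section \<open>Restricted roots of a real Lie algebra\<close>

text \<open>A real Lie algebra is a bracket on a type of class \<open>euclidean_space\<close>. The inner product of
  the class serves only to fix the dimension, the topology and a basis for computing traces; none of
  these notions depends on it.\<close>

definition lin_trace :: "('g::euclidean_space \<Rightarrow> 'g) \<Rightarrow> real" where
  "lin_trace f = (\<Sum>b\<in>Basis. f b \<bullet> b)"

definition killing :: "('g::euclidean_space \<Rightarrow> 'g \<Rightarrow> 'g) \<Rightarrow> 'g \<Rightarrow> 'g \<Rightarrow> real" where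
  "killing br x y = lin_trace (br x \<circ> br y)"

definition compact_lie_algebra :: "('g::euclidean_space \<Rightarrow> 'g \<Rightarrow> 'g) \<Rightarrow> bool" where
  "compact_lie_algebra br \<longleftrightarrow> (\<forall>x. x \<noteq> 0 \<longrightarrow> killing br x x < 0)"

definition cartan_involution :: "('g::euclidean_space \<Rightarrow> 'g \<Rightarrow> 'g) \<Rightarrow> ('g \<Rightarrow> 'g) \<Rightarrow> bool" where
  "cartan_involution br \<theta> \<longleftrightarrow>
     linear \<theta> \<and> (\<forall>x. \<theta> (\<theta> x) = x) \<and> (\<forall>x y. \<theta> (br x y) = br (\<theta> x) (\<theta> y)) \<and>
     (\<forall>x. x \<noteq> 0 \<longrightarrow> killing br x (\<theta> x) < 0)"

text \<open>The Cartan decomposition attached to \<open>\<theta>\<close> consists of its eigenspaces for \<open>1\<close> and \<open>- 1\<close>;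
  the second one is \<open>\<pp>\<close>.\<close>

definition cartan_p :: "('g::euclidean_space \<Rightarrow> 'g) \<Rightarrow> 'g set" where
  "cartan_p \<theta> = {x. \<theta> x = - x}"

definition abelian_subspace :: "('g::real_vector \<Rightarrow> 'g \<Rightarrow> 'g) \<Rightarrow> 'g set \<Rightarrow> bool" where
  "abelian_subspace br A \<longleftrightarrow> subspace A \<and> (\<forall>x\<in>A. \<forall>y\<in>A. br x y = 0)"

definition maximal_abelian_in ::
  "('g::real_vector \<Rightarrow> 'g \<Rightarrow> 'g) \<Rightarrow> 'g set \<Rightarrow> 'g set \<Rightarrow> bool" where
  "maximal_abelian_in br p A \<longleftrightarrow>
     A \<subseteq> p \<and> abelian_subspace br A \<and>
     (\<forall>B. B \<subseteq> p \<and> abelian_subspace br B \<and> A \<subseteq> B \<longrightarrow> B = A)"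

text \<open>A linear functional on a subspace \<open>A\<close> is represented by the function that extends it by zero
  off \<open>A\<close> (and is thus in general not linear on the whole space).\<close>

definition dual_of :: "'g::real_vector set \<Rightarrow> ('g \<Rightarrow> real) set" where
  "dual_of A = {\<beta>. (\<forall>x\<in>A. \<forall>y\<in>A. \<beta> (x + y) = \<beta> x + \<beta> y) \<and>
     (\<forall>r. \<forall>x\<in>A. \<beta> (r *\<^sub>R x) = r * \<beta> x) \<and> (\<forall>x. x \<notin> A \<longrightarrow> \<beta> x = 0)}"

definition root_space ::
  "('g::real_vector \<Rightarrow> 'g \<Rightarrow> 'g) \<Rightarrow> 'g set \<Rightarrow> ('g \<Rightarrow> real) \<Rightarrow> 'g set" where
  "root_space br A \<beta> = {x. \<forall>h\<in>A. br h x = \<beta> h *\<^sub>R x}"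

definition restricted_roots ::
  "('g::real_vector \<Rightarrow> 'g \<Rightarrow> 'g) \<Rightarrow> 'g set \<Rightarrow> ('g \<Rightarrow> real) set" where
  "restricted_roots br A = {\<beta> \<in> dual_of A. \<beta> \<noteq> (\<lambda>_. 0) \<and> root_space br A \<beta> \<noteq> {0}}"

text \<open>Positive systems are those given by the regular elements \<open>h\<^sub>0\<close>, that is, by the Weyl
  chambers.\<close>

definition positive_system ::
  "('g::real_vector \<Rightarrow> 'g \<Rightarrow> 'g) \<Rightarrow> 'g set \<Rightarrow> ('g \<Rightarrow> real) set \<Rightarrow> bool" where
  "positive_system br A P \<longleftrightarrow>
     (\<exists>h\<^sub>0\<in>A. (\<forall>\<beta>\<in>restricted_roots br A. \<beta> h\<^sub>0 \<noteq> 0) \<and>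
        P = {\<beta> \<in> restricted_roots br A. \<beta> h\<^sub>0 > 0})"

text \<open>The highest root is the greatest root for the usual partial order, in which \<open>\<beta> \<le> \<psi>\<close> iff
  \<open>\<psi> - \<beta>\<close> is a sum of positive roots with natural number coefficients.\<close>

definition highest_root ::
  "('g::real_vector \<Rightarrow> 'g \<Rightarrow> 'g) \<Rightarrow> 'g set \<Rightarrow> ('g \<Rightarrow> real) set \<Rightarrow> ('g \<Rightarrow> real) \<Rightarrow> bool" where
  "highest_root br A P \<psi> \<longleftrightarrow>
     \<psi> \<in> P \<and>
     (\<forall>\<beta>\<in>restricted_roots br A.
        \<exists>c :: ('g \<Rightarrow> real) \<Rightarrow> nat. \<forall>h\<in>A. \<psi> h - \<beta> h = (\<Sum>\<gamma>\<in>P. real (c \<gamma>) * \<gamma> h))"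

definition iwasawa_n ::
  "('g::real_vector \<Rightarrow> 'g \<Rightarrow> 'g) \<Rightarrow> 'g set \<Rightarrow> ('g \<Rightarrow> real) set \<Rightarrow> 'g set" where
  "iwasawa_n br A P = span (\<Union>\<beta>\<in>P. root_space br A \<beta>)"

definition lie_center :: "('g::zero \<Rightarrow> 'g \<Rightarrow> 'g) \<Rightarrow> 'g set \<Rightarrow> 'g set" where
  "lie_center br N = {x \<in> N. \<forall>y\<in>N. br x y = 0}"

text \<open>Here \<open>e\<close> is meant to be a suitably normalised vector in the highest root space; the pair
  \<open>(e, 0)\<close> is its image in the complexification.\<close>

definition Omin_split :: "('g::euclidean_space \<Rightarrow> 'g \<Rightarrow> 'g) \<Rightarrow> 'g \<Rightarrow> bool" where
  "Omin_split br e \<longleftrightarrow>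
     simple_lie_algebra cscale (complexify br) \<and> (e, 0) \<in> O_min (complexify br)"

end

theory Submission
  imports Defs
begin

text \<open>
  The centre of \<open>\<nn>\<close> is the highest restricted root space: a root vector centralizing \<open>\<nn>\<close> belongs to a
  dominant root, and positivity of the form \<open>- killing x (\<theta> y)\<close> forces that root to be \<open>\<psi>\<close>.
  On the other side, the minimal nilpotent orbit of a simple complex Lie algebra consists of the
  extremal elements, that is, the nonzero \<open>x\<close> for which \<open>(ad x)\<^sup>2\<close> has range in the line of \<open>x\<close>.
  Such elements are found in the closure of every nonzero nilpotent orbit by maximising a moment map,
  they are conjugate to each other by an \<open>sl\<^sub>2\<close>-argument, and together with \<open>0\<close> they form a closed set.
  Finally \<open>(ad e)\<^sup>2\<close> maps \<open>\<gg>\<close> onto the highest root space, so that \<open>e\<close> is extremal in the complexification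
  iff that space is a line; in this case the complexification is simple, since otherwise \<open>\<gg>\<close> would carry
  a complex structure preserving the line.
\<close>

section \<open>Linear algebra\<close>

text \<open>Everything rests on the form \<open>B x y = - killing br x (\<theta> y)\<close>. It is
  positive definite and the adjoint of ad x is - ad (\<theta> x), so each element of the
  (-1)-eigenspace of \<theta> acts diagonalizably with real eigenvalues. The complexification is
  handled as a real Lie algebra with a conjugate linear Cartan involution; the same arguments thus
  serve both algebras. The obstacle is that \<open>O_min\<close> is a definite description: one
  orbit must be shown to be the only minimal one. Hence an extremal element is sought in the closure
  of every nonzero nilpotent orbit, knowing only that this closure is a cone stable under the group.
  The cone property comes from an h with [h, x] = x, whose complex multiples rescale x inside its
  orbit. The search imitates highest weight orbits: where the moment map is longest relative to the
  vector, its value h singles out a top eigenspace of ad h, and the vectors of the cone in this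
  eigenspace all have moment image along h. This rigidity forces the eigenspace to be a complex
  line.\<close>

lemma lin_trace_compose_commute:
  fixes f g :: "'g::euclidean_space \<Rightarrow> 'g"
  assumes "linear f" "linear g"
  shows "lin_trace (f \<circ> g) = lin_trace (g \<circ> f)"
proof -
  have expand: "f' (g' b) \<bullet> b = (\<Sum>c\<in>Basis. (g' b \<bullet> c) * (f' c \<bullet> b))"
    if "linear f'" for f' g' :: "'g \<Rightarrow> 'g" and b
  proof -
    have "f' (g' b) = f' (\<Sum>c\<in>Basis. (g' b \<bullet> c) *\<^sub>R c)"
      by (simp add: euclidean_representation)
    also have "\<dots> = (\<Sum>c\<in>Basis. (g' b \<bullet> c) *\<^sub>R f' c)"
      using that by (simp add: linear_sum linear_cmul)
    finally show ?thesis by (simp add: inner_sum_left)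
  qed
  have "lin_trace (f \<circ> g) = (\<Sum>b\<in>Basis. \<Sum>c\<in>Basis. (g b \<bullet> c) * (f c \<bullet> b))"
    by (simp add: lin_trace_def expand[OF assms(1)])
  also have "\<dots> = (\<Sum>c\<in>Basis. \<Sum>b\<in>Basis. (g b \<bullet> c) * (f c \<bullet> b))"
    by (rule sum.swap)
  also have "\<dots> = lin_trace (g \<circ> f)"
    by (simp add: lin_trace_def expand[OF assms(2)] mult.commute)
  finally show ?thesis .
qed

lemma funpow_linear: "linear f \<Longrightarrow> linear (f ^^ n)"
  for f :: "'v::real_vector \<Rightarrow> 'v"
  by (induction n) (simp_all only: funpow.simps linear_id linear_compose)

text \<open>\<open>p j\<close> projects onto \<open>range (N ^^ j)\<close>. Since \<open>N\<close>
  maps this range into the next one, cyclicity lets \<open>p j\<close> be traded for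
  \<open>p (Suc j)\<close> in the trace of \<open>N \<circ> p j\<close>; the chain runs from the
  identity down to 0.\<close>

lemma lin_trace_nilpotent:
  fixes N :: "'g::euclidean_space \<Rightarrow> 'g"
  assumes lin: "linear N" and nil: "\<forall>y. (N ^^ n) y = 0"
  shows "lin_trace N = 0"
proof -
  have "\<exists>p. linear p \<and> range p \<subseteq> range (N ^^ j) \<and> (\<forall>v\<in>range (N ^^ j). p v = v)" for j
    using linear_exists_left_inverse_on[of "\<lambda>x. x" "range (N ^^ j)"]
      linear_subspace_image[OF funpow_linear[OF lin] subspace_UNIV]
    by (auto simp: linear_ident)
  then obtain p where p: "\<And>j. linear (p j)" "\<And>j v. p j v \<in> range (N ^^ j)"
    "\<And>j v. v \<in> range (N ^^ j) \<Longrightarrow> p j v = v"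
    by (metis range_subsetD)
  have step: "lin_trace (N \<circ> p j) = lin_trace (N \<circ> p (Suc j))" for j
  proof -
    have *: "p (Suc j) (N (p j v)) = N (p j v)" for v
      using p(2)[of j v] by (auto intro!: p(3))
    have "v \<in> range (N ^^ j)" if "v \<in> range (N ^^ Suc j)" for v
      using that unfolding funpow_Suc_right by auto
    then have **: "p j (p (Suc j) v) = p (Suc j) v" for v
      by (intro p(3)) (use p(2) in blast)
    have "lin_trace (N \<circ> p j) = lin_trace (p (Suc j) \<circ> (N \<circ> p j))"
      by (simp add: lin_trace_def *)
    also have "\<dots> = lin_trace ((N \<circ> p j) \<circ> p (Suc j))"
      by (intro lin_trace_compose_commute p linear_compose lin)
    also have "\<dots> = lin_trace (N \<circ> p (Suc j))"
      by (simp add: lin_trace_def **)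
    finally show ?thesis .
  qed
  have "lin_trace (N \<circ> p 0) = lin_trace (N \<circ> p j)" for j
  proof (induction j)
    case (Suc j)
    then show ?case using step[of j] by (rule trans)
  qed simp
  from this[of n] have "lin_trace (N \<circ> p 0) = lin_trace (N \<circ> p n)" .
  moreover have "p 0 = id" using p(3)[of _ 0] by auto
  moreover have "p n = (\<lambda>v. 0)"
  proof
    show "p n v = 0" for v using p(2)[of n v] nil by auto
  qed
  ultimately show ?thesis by (simp add: lin_trace_def linear_0[OF lin])
qed

text \<open>At most one summand per subspace, and none of them zero: an index that occurs is then a
  genuine eigenvalue or root, and so is the maximum over a finite index set of eigenvalues.\<close>

lemma in_span_Union_subspaces:
  fixes V :: "'i \<Rightarrow> 'v::real_vector set"
  assumes "w \<in> span (\<Union>i\<in>I. V i)" and sub: "\<And>i. i \<in> I \<Longrightarrow> subspace (V i)"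
  shows "\<exists>F c. finite F \<and> F \<subseteq> I \<and> (\<forall>i\<in>F. c i \<in> V i \<and> c i \<noteq> 0) \<and> w = sum c F"
proof -
  have "\<exists>F c. finite F \<and> F \<subseteq> I \<and> (\<forall>i\<in>F. c i \<in> V i) \<and> w = sum c F"
    using assms(1)
  proof (induction rule: span_induct_alt)
    case base
    show ?case by (rule exI[of _ "{}"]) auto
  next
    case (step r x y)
    then obtain i F c where i: "i \<in> I" "x \<in> V i"
      and c: "finite F" "F \<subseteq> I" "\<forall>i\<in>F. c i \<in> V i" "y = sum c F" by blast
    define d where "d j = (if j \<in> F then c j else 0) + (if j = i then r *\<^sub>R x else 0)" for j
    have "sum d (insert i F) = r *\<^sub>R x + y"
      using c(1,4) by (simp add: d_def sum.distrib sum.inter_restrict[symmetric] Int_absorb1 subset_insertI add.commute)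
    moreover have "d j \<in> V j" if "j \<in> insert i F" for j
      using that i c sub by (auto simp: d_def subspace_add subspace_scale subspace_0)
    ultimately show ?case
      using c(1,2) i(1) by (intro exI[of _ "insert i F"] exI[of _ d]) auto
  qed
  then obtain F c where F: "finite F" "F \<subseteq> I" "\<forall>i\<in>F. c i \<in> V i" "w = sum c F" by blast
  then have "w = sum c {i\<in>F. c i \<noteq> 0}"
    by (simp only: F(4)) (rule sum.mono_neutral_right, auto)
  with F show ?thesis
    by (intro exI[of _ "{i\<in>F. c i \<noteq> 0}"] exI[of _ c]) auto
qed

lemma quadratic_nonneg_linear_term:
  fixes q d :: real
  assumes "\<And>t. 0 \<le> 2 * t * q + t\<^sup>2 * d"
  shows "q = 0"
proof (rule ccontr)
  assume "q \<noteq> 0"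
  \<comment> \<open>The vertex of the parabola after \<open>d\<close> is enlarged to the positive
    number \<open>\<bar>d\<bar> + 1\<close>, which also covers \<open>d = 0\<close>.\<close>
  define t where "t = - q / (\<bar>d\<bar> + 1)"
  have "2 * t * q + t\<^sup>2 * d \<le> 2 * t * q + t\<^sup>2 * (\<bar>d\<bar> + 1)"
    by (simp add: mult_left_mono)
  also have "\<dots> = - (q\<^sup>2 / (\<bar>d\<bar> + 1))"
  proof -
    have "\<bar>d\<bar> + 1 \<noteq> 0" by linarith
    then have "t * (\<bar>d\<bar> + 1) = - q" by (simp add: t_def)
    then have "t\<^sup>2 * (\<bar>d\<bar> + 1) = - q * t" by (simp add: power2_eq_square mult.assoc)
    then have "2 * t * q + t\<^sup>2 * (\<bar>d\<bar> + 1) = q * t" by simp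
    then show ?thesis by (simp add: t_def power2_eq_square)
  qed
  also have "\<dots> < 0" using \<open>q \<noteq> 0\<close> by (simp add: divide_pos_pos)
  finally show False using assms[of t] by simp
qed

section \<open>Spectral theory for operators symmetric under a positive definite form\<close>

locale pos_def_form =
  fixes B :: "'v::euclidean_space \<Rightarrow> 'v \<Rightarrow> real"
  assumes B_bilinear: "bilinear B"
    and B_sym: "B x y = B y x"
    and B_pos: "x \<noteq> 0 \<Longrightarrow> B x x > 0"
begin

lemmas B_simps = bilinear_ladd[OF B_bilinear] bilinear_radd[OF B_bilinear]
  bilinear_lsub[OF B_bilinear] bilinear_rsub[OF B_bilinear]
  bilinear_lmul[OF B_bilinear] bilinear_rmul[OF B_bilinear]
  bilinear_lneg[OF B_bilinear] bilinear_rneg[OF B_bilinear]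
  bilinear_lzero[OF B_bilinear] bilinear_rzero[OF B_bilinear]

lemma B_sum_left: "B (\<Sum>i\<in>F. f i) y = (\<Sum>i\<in>F. B (f i) y)"
  by (induction F rule: infinite_finite_induct) (auto simp: B_simps)

lemma B_eq_0_iff [simp]: "B x x = 0 \<longleftrightarrow> x = 0"
  using B_pos[of x] by (cases "x = 0") (auto simp: B_simps)

lemma B_nonneg: "B x x \<ge> 0"
  using B_pos[of x] by (cases "x = 0") (auto simp: B_simps)

lemma B_continuous_on:
  "continuous_on S f \<Longrightarrow> continuous_on S g \<Longrightarrow> continuous_on S (\<lambda>x. B (f x) (g x))"
  using B_bilinear bilinear_conv_bounded_bilinear bounded_bilinear.continuous_on by blast

text \<open>Maximize the Rayleigh quotient. The residual \<open>y = l *\<^sub>R x - T x\<close> is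
  itself an admissible direction in \<open>S\<close>, and the first variation in this direction is a
  multiple of \<open>B y y\<close>, so the residual vanishes. The sphere of the ambient norm only
  supplies compactness; symmetry refers to \<open>B\<close>.\<close>

lemma top_eigenvector:
  assumes S: "subspace S" "S \<noteq> {0}"
    and T: "linear T" "\<And>x. x \<in> S \<Longrightarrow> T x \<in> S" "\<And>x y. B (T x) y = B x (T y)"
  obtains l x where "x \<in> S" "x \<noteq> 0" "T x = l *\<^sub>R x" "\<And>y. y \<in> S \<Longrightarrow> B (T y) y \<le> l * B y y"
proof -
  define R where "R x = B (T x) x / B x x" for x
  define K where "K = S \<inter> sphere 0 1"
  have "compact K"
    unfolding K_def using closed_subspace[OF S(1)] by (intro closed_Int_compact) auto
  moreover have "K \<noteq> {}"
  proof -
    obtain x where "x \<in> S" "x \<noteq> 0" using S subspace_0[OF S(1)] by blast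
    then have "(1 / norm x) *\<^sub>R x \<in> K"
      by (simp add: K_def subspace_scale[OF S(1)])
    then show ?thesis by blast
  qed
  moreover have "continuous_on K R"
    unfolding R_def
    by (intro continuous_on_divide B_continuous_on linear_continuous_on_compose[OF _ T(1)]
        continuous_on_id) (auto simp: K_def)
  ultimately obtain x where x: "x \<in> K" "\<And>y. y \<in> K \<Longrightarrow> R y \<le> R x"
    using continuous_attains_sup[of K R] by blast
  define l where "l = R x"
  have xS: "x \<in> S" "x \<noteq> 0" using x(1) by (auto simp: K_def)
  have bound: "B (T y) y \<le> l * B y y" if "y \<in> S" for y
  proof (cases "y = 0")
    case False
    have "(1 / norm y) *\<^sub>R y \<in> K"
      using False that by (simp add: K_def subspace_scale[OF S(1)])
    from x(2)[OF this] have "R y \<le> l"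
      using False by (simp add: R_def l_def linear_cmul[OF T(1)] B_simps)
    then show ?thesis using B_pos[OF False] by (simp add: R_def field_simps)
  qed (simp add: B_simps linear_0[OF T(1)])
  define y where "y = l *\<^sub>R x - T x"
  have yS: "y \<in> S"
    unfolding y_def by (intro subspace_diff subspace_scale S T(2) xS)
  have "B y y = 0"
  proof (rule quadratic_nonneg_linear_term)
    fix t :: real
    have xx: "l * B x x = B (T x) x" using xS by (simp add: l_def R_def)
    have "x + t *\<^sub>R y \<in> S" by (intro subspace_add subspace_scale S xS yS)
    from bound[OF this]
    have "0 \<le> l * B (x + t *\<^sub>R y) (x + t *\<^sub>R y) - B (T (x + t *\<^sub>R y)) (x + t *\<^sub>R y)" by simp
    also have "\<dots> = 2 * t * (l * B x y - B (T x) y) + t\<^sup>2 * (l * B y y - B (T y) y)"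
      using xx T(3)[of y x]
      by (simp add: linear_add[OF T(1)] linear_cmul[OF T(1)] B_simps B_sym[of y "T x"]
          B_sym[of y x] algebra_simps power2_eq_square)
    also have "l * B x y - B (T x) y = B (l *\<^sub>R x - T x) y" by (simp only: B_simps real_scaleR_def)
    also have "l *\<^sub>R x - T x = y" by (simp only: y_def)
    finally show "0 \<le> 2 * t * B y y + t\<^sup>2 * (l * B y y - B (T y) y)" .
  qed
  then have "T x = l *\<^sub>R x" by (simp add: y_def)
  then show ?thesis using that xS bound by blast
qed

definition selfadjoint_family :: "('v \<Rightarrow> 'v) set \<Rightarrow> bool" where
  "selfadjoint_family F \<longleftrightarrow>
     (\<forall>T\<in>F. linear T \<and> (\<forall>x y. B (T x) y = B x (T y)) \<and> (\<forall>U\<in>F. \<forall>x. T (U x) = U (T x)))"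

text \<open>\<open>F\<close> may be infinite, so the induction is on the dimension: a member that is
  not scalar on \<open>S\<close> has a proper nonzero eigenspace there, and the commuting members
  preserve it.\<close>

lemma joint_eigenvector:
  assumes F: "selfadjoint_family F"
    and "subspace S" "S \<noteq> {0}" "\<forall>T\<in>F. T ` S \<subseteq> S"
  shows "\<exists>x\<in>S. x \<noteq> 0 \<and> (\<forall>T\<in>F. \<exists>\<mu>. T x = \<mu> *\<^sub>R x)"
  using assms(2-4)
proof (induction "dim S" arbitrary: S rule: less_induct)
  case less
  show ?case
  proof (cases "\<forall>T\<in>F. \<exists>\<mu>. \<forall>x\<in>S. T x = \<mu> *\<^sub>R x")
    case True
    obtain x where "x \<in> S" "x \<noteq> 0" using less.prems(1,2) subspace_0 by blast
    then show ?thesis using True by blast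
  next
    case False
    then obtain T where T: "T \<in> F" "\<nexists>\<mu>. \<forall>x\<in>S. T x = \<mu> *\<^sub>R x" by blast
    have TF: "linear T" "\<And>x y. B (T x) y = B x (T y)" "\<And>U x. U \<in> F \<Longrightarrow> T (U x) = U (T x)"
      "\<And>x. x \<in> S \<Longrightarrow> T x \<in> S"
      using F T(1) less.prems(3) unfolding selfadjoint_family_def by blast+
    obtain x l where x: "x \<in> S" "x \<noteq> 0" "T x = l *\<^sub>R x"
      by (rule top_eigenvector[OF less.prems(1,2) TF(1,4,2)]) blast+
    define S' where "S' = {y \<in> S. T y = l *\<^sub>R y}"
    have sub: "subspace S'"
      using less.prems(1) TF(1)
      by (auto simp: S'_def subspace_def linear_add linear_cmul linear_0 scaleR_add_right)
    have S': "S' \<subseteq> S" "S' \<noteq> S" using T(2) unfolding S'_def by blast+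
    then have "dim S' < dim S"
      using subspace_dim_equal[OF sub less.prems(1)] by linarith
    moreover have "S' \<noteq> {0}" using x unfolding S'_def by blast
    moreover have "\<forall>U\<in>F. U ` S' \<subseteq> S'"
    proof (intro ballI subsetI)
      fix U z assume U: "U \<in> F" and "z \<in> U ` S'"
      then obtain y where y: "y \<in> S'" "z = U y" by blast
      have "linear U" using F U by (auto simp: selfadjoint_family_def)
      then have "T z = l *\<^sub>R z"
        using y TF(3)[OF U, of y] by (simp add: S'_def linear_cmul)
      moreover have "z \<in> S" using y U less.prems(3) unfolding S'_def by blast
      ultimately show "z \<in> S'" by (simp add: S'_def)
    qed
    ultimately have "\<exists>x\<in>S'. x \<noteq> 0 \<and> (\<forall>T\<in>F. \<exists>\<mu>. T x = \<mu> *\<^sub>R x)"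
      using less.hyps[of S'] sub by blast
    then show ?thesis using S'(1) by blast
  qed
qed

lemma span_joint_eigenvectors:
  assumes F: "selfadjoint_family F" and "subspace S" "\<forall>T\<in>F. T ` S \<subseteq> S"
  shows "S \<subseteq> span {x. \<forall>T\<in>F. \<exists>\<mu>. T x = \<mu> *\<^sub>R x}" (is "_ \<subseteq> span ?E")
  using assms(2,3)
proof (induction "dim S" arbitrary: S rule: less_induct)
  case less
  show ?case
  proof (cases "S = {0}")
    case True
    then show ?thesis by (simp add: span_0)
  next
    case False
    obtain x where x: "x \<in> S" "x \<noteq> 0" "x \<in> ?E"
      using joint_eigenvector[OF F less.prems(1) False less.prems(2)] by blast
    define S' where "S' = {y \<in> S. B x y = 0}"
    have sub: "subspace S'"
      using less.prems(1) by (auto simp: S'_def subspace_def B_simps)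
    have "x \<notin> S'" using x(2) by (simp add: S'_def)
    then have "S' \<subseteq> S" "S' \<noteq> S" using x(1) unfolding S'_def by blast+
    then have "dim S' < dim S"
      using subspace_dim_equal[OF sub less.prems(1)] by linarith
    moreover have "\<forall>T\<in>F. T ` S' \<subseteq> S'"
    proof (intro ballI subsetI)
      fix T z assume T: "T \<in> F" and "z \<in> T ` S'"
      then obtain y where y: "y \<in> S'" "z = T y" by blast
      obtain \<mu> where "T x = \<mu> *\<^sub>R x" using x(3) T by blast
      moreover have "B x (T y) = B (T x) y" using F T unfolding selfadjoint_family_def by simp
      ultimately have "B x (T y) = \<mu> * B x y" by (simp add: B_simps)
      moreover have "z \<in> S" using y T less.prems(2) unfolding S'_def by blast
      ultimately show "z \<in> S'" using y by (simp add: S'_def)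
    qed
    ultimately have IH: "S' \<subseteq> span ?E" using less.hyps[of S'] sub by blast
    show ?thesis
    proof
      fix y assume y: "y \<in> S"
      define r where "r = B x y / B x x"
      have "y - r *\<^sub>R x \<in> S'"
        using x(1,2) y less.prems(1) by (simp add: S'_def r_def B_simps subspace_diff subspace_scale)
      then have "y - r *\<^sub>R x \<in> span ?E" using IH by blast
      moreover have "r *\<^sub>R x \<in> span ?E" by (intro span_scale span_base x(3))
      ultimately have "(y - r *\<^sub>R x) + r *\<^sub>R x \<in> span ?E" by (rule span_add)
      then show "y \<in> span ?E" by simp
    qed
  qed
qed

lemma eigenvector_decomposition:
  assumes T: "linear T" "\<And>x y. B (T x) y = B x (T y)"
  obtains M c where "finite M" "\<And>\<mu>. \<mu> \<in> M \<Longrightarrow> T (c \<mu>) = \<mu> *\<^sub>R c \<mu>"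
    "\<And>\<mu>. \<mu> \<in> M \<Longrightarrow> c \<mu> \<noteq> 0" "w = sum c M"
proof -
  have "w \<in> span {x. \<forall>U\<in>{T}. \<exists>\<mu>. U x = \<mu> *\<^sub>R x}"
    using span_joint_eigenvectors[OF _ subspace_UNIV, of "{T}"] T
    by (auto simp: selfadjoint_family_def)
  also have "{x. \<forall>U\<in>{T}. \<exists>\<mu>. U x = \<mu> *\<^sub>R x} = (\<Union>\<mu>\<in>UNIV. {x. T x = \<mu> *\<^sub>R x})" by auto
  finally have "\<exists>F c. finite F \<and> F \<subseteq> UNIV \<and> (\<forall>i\<in>F. c i \<in> {x. T x = i *\<^sub>R x} \<and> c i \<noteq> 0) \<and> w = sum c F"
    by (rule in_span_Union_subspaces)
      (auto simp: subspace_def linear_0[OF T(1)] linear_add[OF T(1)] linear_cmul[OF T(1)] algebra_simps)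
  then show ?thesis using that by blast
qed

lemma eigenvectors_orthogonal:
  assumes "\<And>x y. B (T x) y = B x (T y)" "T x = a *\<^sub>R x" "T y = b *\<^sub>R y" "a \<noteq> b"
  shows "B x y = 0"
  using assms(1)[of x y] assms(2-) by (simp add: B_simps)

lemma orthogonal_sum_eq_0:
  assumes "finite F" "sum f F = 0" "\<And>i j. i \<in> F \<Longrightarrow> j \<in> F \<Longrightarrow> i \<noteq> j \<Longrightarrow> B (f i) (f j) = 0" "i \<in> F"
  shows "f i = 0"
proof -
  have "B (f i) (f i) = B (sum f F) (f i)"
    using assms(1,3,4) by (subst B_sum_left, subst sum.remove[of F i]) (auto simp: sum.neutral)
  then show ?thesis using assms(2) by (simp add: B_simps)
qed

lemma functional_separating_subspace:
  assumes "subspace R" "x \<notin> R"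
  obtains z where "\<And>y. y \<in> R \<Longrightarrow> B z y = 0" "B z x \<noteq> 0"
proof -
  obtain u v where uv: "u \<in> span R" "\<And>y. y \<in> span R \<Longrightarrow> orthogonal v y" "x = u + v"
    using orthogonal_subspace_decomp_exists[of R x] by metis
  have R: "span R = R" using assms(1) by (simp add: span_eq_iff)
  have "v \<noteq> 0" using uv assms(2) R by auto
  \<comment> \<open>Riesz representation: \<open>S z\<close> is the vector that represents
    \<open>B z\<close> under the inner product. Definiteness of \<open>B\<close> makes
    \<open>S\<close> injective, hence onto.\<close>
  define S where "S z = (\<Sum>b\<in>Basis. B z b *\<^sub>R b)" for z
  have Sy: "S z \<bullet> y = B z y" for z y
  proof -
    have "B z y = B z (\<Sum>b\<in>Basis. (y \<bullet> b) *\<^sub>R b)" by (simp add: euclidean_representation)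
    also have "\<dots> = (\<Sum>b\<in>Basis. (y \<bullet> b) * B z b)"
      by (subst B_sym, subst B_sum_left) (simp add: B_simps B_sym)
    finally show ?thesis by (simp add: S_def inner_sum_left mult.commute inner_commute[of y])
  qed
  have "linear S"
    by (rule linearI) (simp_all add: S_def B_simps sum.distrib scaleR_sum_right scaleR_add_left)
  moreover have "inj S"
  proof (rule iffD2[OF linear_injective_0[OF \<open>linear S\<close>]], intro allI impI)
    fix z assume "S z = 0"
    then show "z = 0" using Sy[of z z] by simp
  qed
  ultimately obtain z where z: "S z = v"
    using linear_injective_imp_surjective by (metis surjD)
  have "B z y = 0" if "y \<in> R" for y
    using uv(2)[of y] that Sy[of z y] R z by (simp add: orthogonal_def)
  moreover have "B z x \<noteq> 0"
    using uv(2)[OF uv(1)] \<open>v \<noteq> 0\<close> unfolding Sy[symmetric] z uv(3)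
    by (simp add: inner_add_right orthogonal_def)
  ultimately show ?thesis using that by blast
qed

end

section \<open>Inner automorphisms\<close>

text \<open>Coordinates reduce this to Cauchy products of real series. It is applied with
  \<open>h\<close> the bracket, for multiplicativity of the exponential, and with \<open>h\<close>
  the scalar multiplication, for its inverse.\<close>

lemma bilinear_Cauchy_product_sums:
  fixes h :: "'a::euclidean_space \<Rightarrow> 'b::euclidean_space \<Rightarrow> 'c::real_normed_vector"
  assumes h: "bilinear h"
    and a: "summable (\<lambda>k. norm (a k))" and b: "summable (\<lambda>k. norm (b k))"
  shows "(\<lambda>k. \<Sum>i\<le>k. h (a i) (b (k - i))) sums h (suminf a) (suminf b)"
proof -
  have expand: "h u v = (\<Sum>p\<in>Basis. \<Sum>q\<in>Basis. ((u \<bullet> p) * (v \<bullet> q)) *\<^sub>R h p q)" for u v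
  proof -
    have "h u v = h (\<Sum>p\<in>Basis. (u \<bullet> p) *\<^sub>R p) (\<Sum>q\<in>Basis. (v \<bullet> q) *\<^sub>R q)"
      by (simp add: euclidean_representation)
    also have "\<dots> = (\<Sum>p\<in>Basis. \<Sum>q\<in>Basis. ((u \<bullet> p) * (v \<bullet> q)) *\<^sub>R h p q)"
      unfolding bilinear_sum[OF h] sum.cartesian_product
      by (auto simp: bilinear_lmul[OF h] bilinear_rmul[OF h] mult.commute intro!: sum.cong)
    finally show ?thesis .
  qed
  have inner_suminf: "suminf f \<bullet> p = (\<Sum>k. f k \<bullet> p)" "summable (\<lambda>k. norm (f k \<bullet> p))"
    if "summable (\<lambda>k. norm (f k))" for f :: "nat \<Rightarrow> 'd::euclidean_space" and p
  proof -
    have "(\<lambda>k. f k \<bullet> p) sums (suminf f \<bullet> p)"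
      using bounded_linear.sums[OF bounded_linear_inner_left summable_sums[OF summable_norm_cancel[OF that]]] .
    then show "suminf f \<bullet> p = (\<Sum>k. f k \<bullet> p)" by (rule sums_unique)
    have "summable (\<lambda>k. norm (f k) * norm p)" by (rule summable_mult2[OF that])
    then show "summable (\<lambda>k. norm (f k \<bullet> p))"
      by (rule summable_comparison_test[rotated]) (auto simp: Cauchy_Schwarz_ineq2)
  qed
  have "(\<lambda>k. \<Sum>p\<in>Basis. \<Sum>q\<in>Basis. (\<Sum>i\<le>k. (a i \<bullet> p) * (b (k - i) \<bullet> q)) *\<^sub>R h p q) sums
      (\<Sum>p\<in>Basis. \<Sum>q\<in>Basis. ((suminf a \<bullet> p) * (suminf b \<bullet> q)) *\<^sub>R h p q)"
    unfolding inner_suminf(1)[OF a] inner_suminf(1)[OF b]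
    by (intro sums_sum bounded_linear.sums[OF bounded_linear_scaleR_left] Cauchy_product_sums
        inner_suminf(2) a b)
  also have "(\<lambda>k. \<Sum>p\<in>Basis. \<Sum>q\<in>Basis. (\<Sum>i\<le>k. (a i \<bullet> p) * (b (k - i) \<bullet> q)) *\<^sub>R h p q) =
      (\<lambda>k. \<Sum>i\<le>k. h (a i) (b (k - i)))"
  proof
    fix k
    have "(\<Sum>i\<le>k. h (a i) (b (k - i))) =
        (\<Sum>i\<le>k. \<Sum>p\<in>Basis. \<Sum>q\<in>Basis. ((a i \<bullet> p) * (b (k - i) \<bullet> q)) *\<^sub>R h p q)"
      by (simp only: expand[symmetric])
    also have "\<dots> = (\<Sum>p\<in>Basis. \<Sum>i\<le>k. \<Sum>q\<in>Basis. ((a i \<bullet> p) * (b (k - i) \<bullet> q)) *\<^sub>R h p q)"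
      by (rule sum.swap)
    also have "\<dots> = (\<Sum>p\<in>Basis. \<Sum>q\<in>Basis. \<Sum>i\<le>k. ((a i \<bullet> p) * (b (k - i) \<bullet> q)) *\<^sub>R h p q)"
      by (intro sum.cong refl sum.swap)
    finally show "(\<Sum>p\<in>Basis. \<Sum>q\<in>Basis. (\<Sum>i\<le>k. (a i \<bullet> p) * (b (k - i) \<bullet> q)) *\<^sub>R h p q) =
        (\<Sum>i\<le>k. h (a i) (b (k - i)))"
      by (simp add: scaleR_sum_left)
  qed
  also have "(\<Sum>p\<in>Basis. \<Sum>q\<in>Basis. ((suminf a \<bullet> p) * (suminf b \<bullet> q)) *\<^sub>R h p q) =
      h (suminf a) (suminf b)" by (rule expand[symmetric])
  finally show ?thesis .
qed

section \<open>Exponentials of adjoint maps and the group they generate\<close>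

locale real_lie_algebra =
  fixes br :: "'v::euclidean_space \<Rightarrow> 'v \<Rightarrow> 'v"
  assumes lie: "lie_algebra (*\<^sub>R) br"
begin

lemma br_bilinear: "bilinear br"
proof -
  interpret L: lie_algebra "(*\<^sub>R)" br by (rule lie)
  show ?thesis
    unfolding bilinear_def
    by (auto intro!: linearI simp: L.br_add_left L.br_add_right L.br_scale_left L.br_scale_right)
qed

lemmas br_simps = bilinear_ladd[OF br_bilinear] bilinear_radd[OF br_bilinear]
  bilinear_lsub[OF br_bilinear] bilinear_rsub[OF br_bilinear]
  bilinear_lmul[OF br_bilinear] bilinear_rmul[OF br_bilinear]
  bilinear_lneg[OF br_bilinear] bilinear_rneg[OF br_bilinear]
  bilinear_lzero[OF br_bilinear] bilinear_rzero[OF br_bilinear]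

lemma br_linear: "linear (br x)"
  using br_bilinear by (simp add: bilinear_def)

lemma br_sum_right: "br x (\<Sum>i\<in>F. f i) = (\<Sum>i\<in>F. br x (f i))"
  by (rule linear_sum[OF br_linear])

lemma br_sum_left: "br (\<Sum>i\<in>F. f i) x = (\<Sum>i\<in>F. br (f i) x)"
  by (induction F rule: infinite_finite_induct) (auto simp: br_simps)

lemma br_self [simp]: "br x x = 0"
proof -
  interpret L: lie_algebra "(*\<^sub>R)" br by (rule lie)
  show ?thesis by (rule L.br_self)
qed

lemma br_skew: "br x y = - br y x"
proof -
  have "br x y + br y x = 0" using br_self[of "x + y"] unfolding br_simps by (simp add: add.commute)
  then show ?thesis by (simp add: eq_neg_iff_add_eq_0)
qed

lemma br_leibniz: "br x (br y z) = br (br x y) z + br y (br x z)"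
proof -
  interpret L: lie_algebra "(*\<^sub>R)" br by (rule lie)
  have "br y (br z x) = - br y (br x z)" "br z (br x y) = - br (br x y) z"
    by (simp_all only: br_skew[of z] br_simps)
  then have "br x (br y z) - br y (br x z) - br (br x y) z = 0"
    using L.jacobi[of x y z] by simp
  then show ?thesis by (simp add: algebra_simps)
qed

lemma br_continuous_on:
  "continuous_on S f \<Longrightarrow> continuous_on S g \<Longrightarrow> continuous_on S (\<lambda>x. br (f x) (g x))"
  using br_bilinear bilinear_conv_bounded_bilinear bounded_bilinear.continuous_on by blast

lemma funpow_br_scaleR: "(br (t *\<^sub>R x) ^^ n) y = t ^ n *\<^sub>R (br x ^^ n) y"
  by (induction n) (auto simp: br_simps)

lemma funpow_br_linear: "linear (br x ^^ n)"
  by (rule funpow_linear[OF br_linear])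

lemma funpow_br_leibniz:
  "(br x ^^ n) (br y z) = (\<Sum>i\<le>n. real (n choose i) *\<^sub>R br ((br x ^^ i) y) ((br x ^^ (n - i)) z))"
proof (induction n)
  case (Suc n)
  let ?t = "\<lambda>i j. br ((br x ^^ i) y) ((br x ^^ j) z)"
  have "(br x ^^ Suc n) (br y z) =
      (\<Sum>i\<le>n. real (n choose i) *\<^sub>R ?t (Suc i) (n - i)) + (\<Sum>i\<le>n. real (n choose i) *\<^sub>R ?t i (Suc (n - i)))"
    by (simp add: Suc br_sum_right br_simps br_leibniz[of x] scaleR_add_right sum.distrib)
  also have "(\<Sum>i\<le>n. real (n choose i) *\<^sub>R ?t i (Suc (n - i))) = (\<Sum>i\<le>n. real (n choose i) *\<^sub>R ?t i (Suc n - i))"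
    by (intro sum.cong refl) (simp add: Suc_diff_le)
  also have "\<dots> = (\<Sum>i\<le>Suc n. real (n choose i) *\<^sub>R ?t i (Suc n - i))"
    by (simp add: binomial_eq_0)
  also have "\<dots> = ?t 0 (Suc n) + (\<Sum>i\<le>n. real (n choose Suc i) *\<^sub>R ?t (Suc i) (n - i))"
    by (subst sum.atMost_Suc_shift) simp
  also have "(\<Sum>i\<le>n. real (n choose i) *\<^sub>R ?t (Suc i) (n - i)) + \<dots> =
      ?t 0 (Suc n) + (\<Sum>i\<le>n. real (Suc n choose Suc i) *\<^sub>R ?t (Suc i) (n - i))"
    by (simp add: sum.distrib scaleR_add_left)
  also have "\<dots> = (\<Sum>i\<le>Suc n. real (Suc n choose i) *\<^sub>R ?t i (Suc n - i))"
    by (subst sum.atMost_Suc_shift) simp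
  finally show ?case .
qed simp

lemma summable_norm_exp_ad: "summable (\<lambda>n. norm ((1 / fact n) *\<^sub>R (br x ^^ n) y))"
proof -
  obtain C where C: "C > 0" "\<And>y. norm (br x y) \<le> C * norm y"
    using linear_bounded_pos[OF br_linear] by blast
  have bound: "norm ((br x ^^ n) y) \<le> C ^ n * norm y" for n
  proof (induction n)
    case (Suc n)
    have "norm ((br x ^^ Suc n) y) \<le> C * norm ((br x ^^ n) y)" using C(2) by simp
    also have "\<dots> \<le> C * (C ^ n * norm y)" using Suc C(1) by (intro mult_left_mono) auto
    finally show ?case by (simp add: mult.assoc)
  qed simp
  have "summable (\<lambda>n. inverse (fact n) * C ^ n * norm y)"
    by (intro summable_mult2 summable_exp)
  then show ?thesis
    by (rule summable_comparison_test[rotated])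
      (use bound in \<open>auto simp: divide_inverse mult.assoc intro!: mult_left_mono\<close>)
qed

lemma exp_ad_sums: "(\<lambda>n. (1 / fact n) *\<^sub>R (br x ^^ n) y) sums exp_ad br x y"
  unfolding exp_ad_def by (rule summable_sums[OF summable_norm_cancel[OF summable_norm_exp_ad]])

lemma exp_ad_eqI: "(\<lambda>n. (1 / fact n) *\<^sub>R (br x ^^ n) y) sums z \<Longrightarrow> exp_ad br x y = z"
  using sums_unique2[OF exp_ad_sums] .

lemma exp_ad_linear: "linear (exp_ad br x)"
proof (rule linearI)
  show "exp_ad br x (y + z) = exp_ad br x y + exp_ad br x z" for y z
    by (rule exp_ad_eqI)
      (use sums_add[OF exp_ad_sums[of x y] exp_ad_sums[of x z]] in
        \<open>simp add: linear_add[OF funpow_br_linear] scaleR_add_right\<close>)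
  show "exp_ad br x (r *\<^sub>R y) = r *\<^sub>R exp_ad br x y" for r y
    by (rule exp_ad_eqI)
      (use sums_scaleR_right[OF exp_ad_sums[of x y], of r] in
        \<open>simp add: linear_cmul[OF funpow_br_linear] mult.commute\<close>)
qed

lemma exp_ad_intertwine:
  assumes "linear \<phi>" "\<And>y. \<phi> (br x y) = br x (\<phi> y)"
  shows "\<phi> (exp_ad br x y) = exp_ad br x (\<phi> y)"
proof -
  have "\<phi> ((br x ^^ n) y) = (br x ^^ n) (\<phi> y)" for n
    by (induction n) (auto simp: assms(2))
  then have "(\<lambda>n. (1 / fact n) *\<^sub>R (br x ^^ n) (\<phi> y)) sums \<phi> (exp_ad br x y)"
    using bounded_linear.sums[OF linear_conv_bounded_linear[THEN iffD1, OF assms(1)] exp_ad_sums[of x y]]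
    by (simp add: linear_cmul[OF assms(1)])
  then show ?thesis by (rule exp_ad_eqI[symmetric])
qed

lemma exp_ad_br: "exp_ad br x (br y z) = br (exp_ad br x y) (exp_ad br x z)"
proof (rule exp_ad_eqI)
  let ?e = "\<lambda>y n. (1 / fact n) *\<^sub>R (br x ^^ n) y"
  have "(\<lambda>k. \<Sum>i\<le>k. br (?e y i) (?e z (k - i))) sums br (exp_ad br x y) (exp_ad br x z)"
    unfolding exp_ad_def
    by (rule bilinear_Cauchy_product_sums[OF br_bilinear summable_norm_exp_ad summable_norm_exp_ad])
  moreover have "(\<Sum>i\<le>k. br (?e y i) (?e z (k - i))) = ?e (br y z) k" for k
    unfolding funpow_br_leibniz scaleR_sum_right
    by (intro sum.cong refl) (simp add: br_simps binomial_fact)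
  ultimately show "?e (br y z) sums br (exp_ad br x y) (exp_ad br x z)" by simp
qed

text \<open>In the product of the two series the term of degree k carries the factor
  \<open>(1 + (-1)) ^ k\<close>. The outer exponential acts on the limit of a series, so this limit
  is first resolved into basis coordinates, which turns the composition into a Cauchy
  product.\<close>

lemma exp_ad_minus: "exp_ad br (- x) (exp_ad br x y) = y"
proof -
  let ?e = "\<lambda>x y n. (1 / fact n) *\<^sub>R (br x ^^ n) y"
  define E where "E = exp_ad br x y"
  have "(\<lambda>k. \<Sum>p\<in>Basis. \<Sum>j\<le>k. (?e x y j \<bullet> p) *\<^sub>R ?e (-x) p (k - j)) sums
      (\<Sum>p\<in>Basis. (E \<bullet> p) *\<^sub>R exp_ad br (-x) p)"
  proof (intro sums_sum)
    fix p :: 'v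
    have "summable (\<lambda>k. norm (?e x y k) * norm p)"
      by (rule summable_mult2[OF summable_norm_exp_ad])
    then have "summable (\<lambda>k. norm (?e x y k \<bullet> p))"
    proof (rule summable_comparison_test[rotated])
      show "\<exists>N. \<forall>k\<ge>N. norm (norm (?e x y k \<bullet> p)) \<le> norm (?e x y k) * norm p"
        using Cauchy_Schwarz_ineq2[of "?e x y _" p] by (simp only: real_norm_def abs_idempotent) blast
    qed
    moreover have "bilinear ((*\<^sub>R) :: real \<Rightarrow> 'v \<Rightarrow> 'v)"
      by (auto simp: bilinear_def intro!: linearI simp: scaleR_add_left scaleR_add_right)
    ultimately have "(\<lambda>k. \<Sum>j\<le>k. (?e x y j \<bullet> p) *\<^sub>R ?e (-x) p (k - j)) sums
        ((\<Sum>k. ?e x y k \<bullet> p) *\<^sub>R (\<Sum>k. ?e (-x) p k))"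
      by (intro bilinear_Cauchy_product_sums[where h = "(*\<^sub>R)" and a = "\<lambda>k. ?e x y k \<bullet> p"
            and b = "?e (-x) p"] summable_norm_exp_ad)
    moreover have "(\<Sum>k. ?e x y k \<bullet> p) = E \<bullet> p"
      unfolding E_def
      by (intro sums_unique[symmetric] bounded_linear.sums[OF bounded_linear_inner_left] exp_ad_sums)
    ultimately show "(\<lambda>k. \<Sum>j\<le>k. (?e x y j \<bullet> p) *\<^sub>R ?e (-x) p (k - j)) sums
        ((E \<bullet> p) *\<^sub>R exp_ad br (-x) p)"
      by (simp add: exp_ad_def)
  qed
  also have "(\<Sum>p\<in>Basis. (E \<bullet> p) *\<^sub>R exp_ad br (-x) p) = exp_ad br (-x) (\<Sum>p\<in>Basis. (E \<bullet> p) *\<^sub>R p)"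
    by (simp add: linear_sum[OF exp_ad_linear] linear_cmul[OF exp_ad_linear])
  also have "(\<Sum>p\<in>Basis. (E \<bullet> p) *\<^sub>R p) = E" by (rule euclidean_representation)
  also have "(\<lambda>k. \<Sum>p\<in>Basis. \<Sum>j\<le>k. (?e x y j \<bullet> p) *\<^sub>R ?e (-x) p (k - j)) = (\<lambda>k. if k = 0 then y else 0)"
  proof
    fix k
    have "(\<Sum>p\<in>Basis. \<Sum>j\<le>k. (?e x y j \<bullet> p) *\<^sub>R ?e (-x) p (k - j)) =
        (\<Sum>j\<le>k. \<Sum>p\<in>Basis. (?e x y j \<bullet> p) *\<^sub>R ?e (-x) p (k - j))"
      by (rule sum.swap)
    also have "\<dots> = (\<Sum>j\<le>k. ?e (-x) (?e x y j) (k - j))"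
    proof (rule sum.cong[OF refl])
      fix j
      let ?f = "\<lambda>v. (1 / fact (k - j)) *\<^sub>R (br (-x) ^^ (k - j)) v"
      have lin: "linear ?f" by (intro linear_compose_scale_right funpow_br_linear)
      have "?f (\<Sum>p\<in>Basis. (?e x y j \<bullet> p) *\<^sub>R p) = (\<Sum>p\<in>Basis. ?f ((?e x y j \<bullet> p) *\<^sub>R p))"
        by (rule linear_sum[OF lin])
      also have "\<dots> = (\<Sum>p\<in>Basis. (?e x y j \<bullet> p) *\<^sub>R ?f p)"
        by (intro sum.cong refl linear_cmul[OF lin])
      finally show "(\<Sum>p\<in>Basis. (?e x y j \<bullet> p) *\<^sub>R ?f p) = ?f (?e x y j)"
        by (simp only: euclidean_representation)
    qed
    also have "\<dots> = (\<Sum>j\<le>k. (1 / fact k * (real (k choose j) * 1 ^ j * (-1) ^ (k - j))) *\<^sub>R (br x ^^ k) y)"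
    proof (rule sum.cong[OF refl])
      fix j assume "j \<in> {..k}"
      then have jk: "j \<le> k" by simp
      have "(br (-x) ^^ (k - j)) ((br x ^^ j) y) = (-1) ^ (k - j) *\<^sub>R (br x ^^ k) y"
        using funpow_br_scaleR[where t = "-1" and x = x and n = "k - j" and y = "(br x ^^ j) y"] jk
        by (simp add: comp_apply[of "br x ^^ (k - j)", symmetric] funpow_add[symmetric] del: comp_apply)
      then show "?e (-x) (?e x y j) (k - j) =
          (1 / fact k * (real (k choose j) * 1 ^ j * (-1) ^ (k - j))) *\<^sub>R (br x ^^ k) y"
        using jk by (simp add: linear_cmul[OF funpow_br_linear] binomial_fact)
    qed
    also have "\<dots> = (1 / fact k * (1 + (-1)) ^ k) *\<^sub>R (br x ^^ k) y"
      unfolding binomial_ring sum_distrib_left scaleR_sum_left ..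
    also have "\<dots> = (if k = 0 then y else 0)" by (simp add: power_0_left)
    finally show "(\<Sum>p\<in>Basis. \<Sum>j\<le>k. (?e x y j \<bullet> p) *\<^sub>R ?e (-x) p (k - j)) = (if k = 0 then y else 0)" .
  qed
  finally have "(\<lambda>k. if k = 0 then y else 0) sums exp_ad br (-x) E" .
  then show ?thesis
    using sums_single[of 0 "\<lambda>_. y"] sums_unique2 unfolding E_def by fastforce
qed

lemma exp_ad_eigenvector:
  assumes "br x y = \<mu> *\<^sub>R y"
  shows "exp_ad br x y = exp \<mu> *\<^sub>R y"
proof (rule exp_ad_eqI)
  have "(br x ^^ n) y = \<mu> ^ n *\<^sub>R y" for n
    by (induction n) (auto simp: assms br_simps)
  then show "(\<lambda>n. (1 / fact n) *\<^sub>R (br x ^^ n) y) sums (exp \<mu> *\<^sub>R y)"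
    using bounded_linear.sums[OF bounded_linear_scaleR_left exp_converges[of \<mu>], of y]
    by (simp add: divide_inverse)
qed

lemma exp_ad_two_terms:
  assumes "br x (br x y) = 0"
  shows "exp_ad br x y = y + br x y"
proof (rule exp_ad_eqI)
  have "(br x ^^ n) y = 0" if "n \<notin> {0, 1}" for n
  proof -
    obtain m where "n = Suc (Suc m)" using \<open>n \<notin> {0, 1}\<close> by (metis insertCI nat.exhaust One_nat_def)
    then show ?thesis
      using assms linear_0[OF funpow_br_linear] by (simp add: funpow_swap1)
  qed
  then show "(\<lambda>n. (1 / fact n) *\<^sub>R (br x ^^ n) y) sums (y + br x y)"
    using sums_finite[of "{0, 1}" "\<lambda>n. (1 / fact n) *\<^sub>R (br x ^^ n) y"] by simp
qed

text \<open>A power series in t that vanishes identically has vanishing linear coefficient. This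
  passes from invariance under the group to invariance under ad, without differentiating
  \<open>exp_ad\<close>.\<close>

lemma exp_ad_derivative_vanishes:
  fixes \<phi> :: "'v \<Rightarrow> real"
  assumes "linear \<phi>" "\<And>t. \<phi> (exp_ad br (t *\<^sub>R x) y) = 0"
  shows "\<phi> (br x y) = 0"
proof -
  define a where "a n = \<phi> ((br x ^^ n) y) / fact n" for n
  have sums: "(\<lambda>n. a n * t ^ n) sums 0" for t
    using bounded_linear.sums[OF linear_conv_bounded_linear[THEN iffD1, OF assms(1)] exp_ad_sums[of "t *\<^sub>R x" y]]
      assms(2)[of t]
    by (simp add: funpow_br_scaleR linear_cmul[OF assms(1)] a_def mult.commute)
  have a0: "a 0 = 0" using sums_unique2[OF sums[of 0] powser_sums_zero] by simp
  have "(\<lambda>n. a (Suc n) * t ^ n) sums 0" if "t \<noteq> 0" for t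
  proof -
    have "(\<lambda>n. a (Suc n) * t ^ Suc n) sums 0"
      using sums[of t] a0 sums_Suc_iff[of "\<lambda>n. a n * t ^ n" 0] by simp
    from sums_divide[OF this, of t] show ?thesis using that by (simp add: field_simps)
  qed
  then have "((\<lambda>t. 0) \<longlongrightarrow> a (Suc 0)) (at (0::real))"
    by (intro powser_limit_0_strong[of 1 "\<lambda>n. a (Suc n)"]) auto
  then have "a (Suc 0) = 0" using tendsto_unique tendsto_const trivial_limit_at by metis
  then show ?thesis by (simp add: a_def)
qed

lemma exp_ad_in_group: "exp_ad br x \<in> adjoint_group br"
  using adjoint_group.intros(2)[OF adjoint_group.intros(1)] by simp

lemma adjoint_group_comp:
  "g \<in> adjoint_group br \<Longrightarrow> h \<in> adjoint_group br \<Longrightarrow> g \<circ> h \<in> adjoint_group br"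
  by (induction rule: adjoint_group.induct) (auto simp: comp_assoc intro: adjoint_group.intros)

lemma adjoint_group_linear: "g \<in> adjoint_group br \<Longrightarrow> linear g"
  by (induction rule: adjoint_group.induct)
    (simp_all only: linear_compose exp_ad_linear linear_id)

lemma adjoint_group_br: "g \<in> adjoint_group br \<Longrightarrow> g (br x y) = br (g x) (g y)"
  by (induction rule: adjoint_group.induct) (auto simp: exp_ad_br)

lemma adjoint_group_inverse:
  assumes "g \<in> adjoint_group br"
  obtains h where "h \<in> adjoint_group br" "\<And>x. h (g x) = x" "\<And>x. g (h x) = x"
proof -
  have "\<exists>h\<in>adjoint_group br. (\<forall>x. h (g x) = x) \<and> (\<forall>x. g (h x) = x)"
    using assms
  proof (induction rule: adjoint_group.induct)
    case 1
    then show ?case by (intro bexI[of _ id]) (auto intro: adjoint_group.intros)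
  next
    case (2 g x)
    then obtain h where h: "h \<in> adjoint_group br" "\<forall>x. h (g x) = x" "\<forall>x. g (h x) = x" by blast
    show ?case
      using h exp_ad_minus[of x] exp_ad_minus[of "-x"]
      by (intro bexI[of _ "h \<circ> exp_ad br (-x)"]) (auto intro: adjoint_group_comp exp_ad_in_group)
  qed
  then show ?thesis using that by blast
qed

text \<open>With \<phi> a complex scalar multiplication this makes inner automorphisms complex
  linear, although the group is built from real data.\<close>

lemma adjoint_group_intertwine:
  assumes "g \<in> adjoint_group br" "linear \<phi>" "\<And>x y. \<phi> (br x y) = br x (\<phi> y)"
  shows "\<phi> (g y) = g (\<phi> y)"
  using assms(1)
  by (induction arbitrary: y rule: adjoint_group.induct) (auto simp: exp_ad_intertwine assms)

lemma orbit_self: "x \<in> adjoint_orbit br x"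
  unfolding adjoint_orbit_def by (rule image_eqI[of _ _ id]) (auto intro: adjoint_group.intros)

lemma orbit_group:
  assumes "g \<in> adjoint_group br" "y \<in> adjoint_orbit br x"
  shows "g y \<in> adjoint_orbit br x"
proof -
  obtain h where "h \<in> adjoint_group br" "y = h x" using assms(2) by (auto simp: adjoint_orbit_def)
  then show ?thesis
    unfolding adjoint_orbit_def using adjoint_group_comp[OF assms(1)]
    by (intro image_eqI[of _ _ "g \<circ> h"]) auto
qed

lemma orbit_eq:
  assumes "y \<in> adjoint_orbit br x"
  shows "adjoint_orbit br y = adjoint_orbit br x"
proof -
  have sub: "adjoint_orbit br y \<subseteq> adjoint_orbit br x" if "y \<in> adjoint_orbit br x" for x y
    using orbit_group[OF _ that] by (auto simp: adjoint_orbit_def[of br y])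
  obtain g where g: "g \<in> adjoint_group br" "y = g x" using assms by (auto simp: adjoint_orbit_def)
  obtain h where "h \<in> adjoint_group br" "h y = x" using adjoint_group_inverse[OF g(1)] g(2) by metis
  then have "x \<in> adjoint_orbit br y" by (auto simp: adjoint_orbit_def)
  then show ?thesis using sub assms by blast
qed

lemma closure_orbit_group:
  assumes "g \<in> adjoint_group br" "y \<in> closure (adjoint_orbit br x)"
  shows "g y \<in> closure (adjoint_orbit br x)"
proof -
  have "g ` closure (adjoint_orbit br x) \<subseteq> closure (adjoint_orbit br x)"
    using orbit_group[OF assms(1)] closure_subset
    by (intro image_closure_subset linear_continuous_on
        linear_conv_bounded_linear[THEN iffD1] adjoint_group_linear[OF assms(1)]) blast+
  then show ?thesis using assms(2) by blast
qed

end

section \<open>Cartan involutions\<close>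

context real_lie_algebra
begin

lemma br_eigenvectors:
  assumes "br h x = a *\<^sub>R x" "br h y = b *\<^sub>R y"
  shows "br h (br x y) = (a + b) *\<^sub>R br x y"
  by (simp add: br_leibniz[of h] assms br_simps scaleR_add_left)

lemma killing_alt: "killing br x y = (\<Sum>b\<in>Basis. br x (br y b) \<bullet> b)"
  by (simp add: killing_def lin_trace_def)

lemma killing_bilinear: "bilinear (killing br)"
  unfolding bilinear_def
  by (auto intro!: linearI simp: killing_alt br_simps inner_add_left sum.distrib sum_distrib_left)

lemmas killing_simps = bilinear_ladd[OF killing_bilinear] bilinear_radd[OF killing_bilinear]
  bilinear_lsub[OF killing_bilinear] bilinear_rsub[OF killing_bilinear]
  bilinear_lmul[OF killing_bilinear] bilinear_rmul[OF killing_bilinear]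
  bilinear_lneg[OF killing_bilinear] bilinear_rneg[OF killing_bilinear]
  bilinear_lzero[OF killing_bilinear] bilinear_rzero[OF killing_bilinear]

lemma killing_sym: "killing br x y = killing br y x"
  unfolding killing_def by (rule lin_trace_compose_commute[OF br_linear br_linear])

lemma killing_invariant: "killing br (br x y) z = killing br x (br y z)"
proof -
  have "lin_trace (br y \<circ> (br x \<circ> br z)) = lin_trace ((br x \<circ> br z) \<circ> br y)"
    by (intro lin_trace_compose_commute linear_compose br_linear)
  moreover have "br (br u v) w = br u (br v w) - br v (br u w)" for u v w
    using br_leibniz[of u v w] by (simp add: algebra_simps)
  ultimately show ?thesis
    by (simp add: killing_alt lin_trace_def br_simps inner_diff_left sum_subtractf)
qed

text \<open>ad x and ad z commute, so their product inherits nilpotency from ad x and has trace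
  0.\<close>

lemma killing_nilpotent_commuting:
  assumes "ad_nilpotent br x" "br x z = 0"
  shows "killing br x z = 0"
proof -
  obtain n where n: "\<And>y. (br x ^^ n) y = 0" using assms(1) by (auto simp: ad_nilpotent_def)
  have comm: "br x (br z y) = br z (br x y)" for y
    using br_leibniz[of x z y] assms(2) by (simp add: br_simps)
  have comm_pow: "br x ((br z ^^ k) y) = (br z ^^ k) (br x y)" for k y
    by (induction k) (auto simp: comm)
  have "((br x \<circ> br z) ^^ k) y = (br z ^^ k) ((br x ^^ k) y)" for k y
    by (induction k) (auto simp: comm comm_pow)
  then have "\<forall>y. ((br x \<circ> br z) ^^ n) y = 0"
    by (simp add: n linear_0[OF funpow_br_linear])
  then show ?thesis
    unfolding killing_def by (intro lin_trace_nilpotent linear_compose br_linear)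
qed

end

locale cartan_lie_algebra = real_lie_algebra br
  for br :: "'v::euclidean_space \<Rightarrow> 'v \<Rightarrow> 'v" +
  fixes \<theta> :: "'v \<Rightarrow> 'v"
  assumes cartan: "cartan_involution br \<theta>"
begin

lemma \<theta>_linear: "linear \<theta>" and \<theta>_\<theta> [simp]: "\<theta> (\<theta> x) = x"
  and \<theta>_br: "\<theta> (br x y) = br (\<theta> x) (\<theta> y)"
  using cartan by (auto simp: cartan_involution_def)

lemmas \<theta>_simps = linear_add[OF \<theta>_linear] linear_diff[OF \<theta>_linear] linear_cmul[OF \<theta>_linear]
  linear_neg[OF \<theta>_linear] linear_0[OF \<theta>_linear] \<theta>_br

lemma \<theta>_eq_0_iff [simp]: "\<theta> x = 0 \<longleftrightarrow> x = 0"
  by (metis \<theta>_\<theta> linear_0[OF \<theta>_linear])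

lemma killing_\<theta>: "killing br (\<theta> x) (\<theta> y) = killing br x y"
proof -
  have "killing br (\<theta> x) (\<theta> y) = lin_trace (\<theta> \<circ> (br x \<circ> br y \<circ> \<theta>))"
    by (simp add: killing_alt lin_trace_def \<theta>_br)
  also have "\<dots> = lin_trace ((br x \<circ> br y \<circ> \<theta>) \<circ> \<theta>)"
    by (intro lin_trace_compose_commute linear_compose br_linear \<theta>_linear)
  finally show ?thesis by (simp add: killing_def comp_def)
qed

definition B :: "'v \<Rightarrow> 'v \<Rightarrow> real" where
  "B x y = - killing br x (\<theta> y)"

sublocale pos_def_form B
proof
  show "bilinear B"
    unfolding bilinear_def by (auto intro!: linearI simp: B_def killing_simps \<theta>_simps)
  show "B x y = B y x" for x y
    unfolding B_def using killing_\<theta>[of x "\<theta> y"] killing_sym[of y "\<theta> x"] by simp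
  show "x \<noteq> 0 \<Longrightarrow> B x x > 0" for x
    using cartan by (simp add: B_def cartan_involution_def)
qed

lemma B_br: "B (br x y) z = - B y (br (\<theta> x) z)"
  using killing_invariant[of y x "\<theta> z"] br_skew[of x y] by (simp add: B_def \<theta>_br killing_simps)

lemma killing_eq_B: "killing br x y = - B x (\<theta> y)"
  by (simp add: B_def)

lemma B_br_p: "\<theta> z = - z \<Longrightarrow> B (br z x) y = B x (br z y)"
  by (simp add: B_br br_simps B_simps)

text \<open>Used to make the spectrum of ad h symmetric about 0: an upper bound for the eigenvalues
  is also a bound for their negatives.\<close>

lemma \<theta>_eigenvector:
  assumes "\<theta> h = - h" "br h x = a *\<^sub>R x"
  shows "br h (\<theta> x) = - a *\<^sub>R \<theta> x"
proof -
  have "br (\<theta> h) (\<theta> x) = a *\<^sub>R \<theta> x" using assms(2) by (metis \<theta>_br linear_cmul[OF \<theta>_linear])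
  then show ?thesis by (simp add: assms(1) br_simps minus_equation_iff[of "br h (\<theta> x)"])
qed

text \<open>The range of \<open>ad x\<close> is the Killing-orthogonal complement of the centralizer of \<open>x\<close>, and a nilpotent
  element is orthogonal to its centralizer.\<close>

lemma nilpotent_in_range:
  assumes "ad_nilpotent br x"
  obtains h where "br h x = x"
proof -
  have "x \<in> range (br x)"
  proof (rule ccontr)
    assume "x \<notin> range (br x)"
    moreover have "subspace (range (br x))"
      by (intro linear_subspace_image br_linear subspace_UNIV)
    ultimately obtain z where z: "\<And>y. y \<in> range (br x) \<Longrightarrow> B z y = 0" "B z x \<noteq> 0"
      using functional_separating_subspace by blast
    \<comment> \<open>Testing \<open>z\<close> against this element of the range and moving ad x to
      its adjoint - ad (\<theta> x) shows that \<open>\<theta> z\<close> centralizes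
      \<open>x\<close>.\<close>
    have "B (br (\<theta> x) z) (br (\<theta> x) z) = 0"
      using z(1)[of "br x (br (\<theta> x) z)"] by (simp add: B_br)
    then have "br x (\<theta> z) = 0"
      using \<theta>_br[of "\<theta> x" z] linear_0[OF \<theta>_linear] by simp
    then have "killing br x (\<theta> z) = 0" by (rule killing_nilpotent_commuting[OF assms])
    then show False using z(2) by (simp add: killing_eq_B B_sym)
  qed
  then obtain k where "x = br x k" by blast
  then have "br (- k) x = x" by (simp add: br_simps br_skew[of k x])
  then show ?thesis using that by blast
qed

text \<open>The moment map: for z in the (-1)-eigenspace of \<theta>, \<open>B z (mu x)\<close> is
  the derivative of half the squared length of x along exp (t ad z), which is the content of
  \<open>B_mu\<close>.\<close>

definition mu :: "'v \<Rightarrow> 'v" where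
  "mu x = - br x (\<theta> x)"

lemma \<theta>_mu: "\<theta> (mu x) = - mu x"
  by (simp add: mu_def \<theta>_simps br_skew[of "\<theta> x" x])

lemma mu_scaleR: "mu (r *\<^sub>R x) = r\<^sup>2 *\<^sub>R mu x"
  by (simp add: mu_def \<theta>_simps br_simps power2_eq_square)

lemma B_mu: "B (br z x) x = B z (mu x)"
  using B_br[of x z x] br_skew[of z x] br_skew[of x "\<theta> x"] by (simp add: mu_def B_simps)

lemma mu_eigenvalue:
  assumes "br (mu x) x = k *\<^sub>R x"
  shows "B (mu x) (mu x) = k * B x x"
  using B_mu[of "mu x" x] assms by (simp add: B_simps)

text \<open>In sl2 terms, the square of the lowering operator is injective on the weight space of
  \<open>e\<close>. With - ad (\<theta> e) as adjoint of ad e, the squared lengths of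
  \<open>br e v\<close> and \<open>br e z\<close> become computable; the first is 0, and the second
  would be negative if \<open>z\<close> were nonzero.\<close>

lemma weight_vector_eq_0:
  assumes e: "br (mu e) e = k *\<^sub>R e" "k > 0"
    and z: "br (mu e) z = k *\<^sub>R z" "br (\<theta> e) (br (\<theta> e) z) = 0"
  shows "z = 0"
proof -
  have comm: "br (\<theta> e) (br e w) = br (mu e) w + br e (br (\<theta> e) w)" for w
    using br_leibniz[of "\<theta> e" e w] br_skew[of "\<theta> e" e] by (simp add: mu_def)
  define v where "v = br (\<theta> e) z"
  have \<theta>v: "br (\<theta> e) v = 0" using z(2) by (simp add: v_def)
  have "br (mu e) v = 0"
    using br_eigenvectors[OF \<theta>_eigenvector[OF \<theta>_mu e(1)] z(1)] by (simp add: v_def)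
  then have "B (br e v) (br e v) = 0"
    by (simp add: B_br comm \<theta>v br_simps B_simps)
  then have "br e v = 0" by simp
  then have "B v v = 0" using B_br[of "\<theta> e" z v] by (simp add: v_def B_simps)
  then have v: "br (\<theta> e) z = 0" by (simp add: v_def)
  have "B (br e z) (br e z) = - (k * B z z)"
    by (simp add: B_br comm z(1) v br_simps B_simps)
  then have "k * B z z \<le> 0" using B_nonneg[of "br e z"] by linarith
  then show ?thesis using e(2) B_pos[of z] by (cases "z = 0") (auto simp: mult_le_0_iff)
qed

text \<open>exp (t ad z) multiplies the component of eigenvalue \<mu> by exp (t \<mu>). After
  rescaling by the fastest growth only the top component survives the limit, and a closed cone keeps
  it.\<close>

lemma exp_limit_component:
  assumes X: "closed X" "\<And>x t. x \<in> X \<Longrightarrow> exp_ad br (t *\<^sub>R z) x \<in> X"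
      "\<And>x r. x \<in> X \<Longrightarrow> r > 0 \<Longrightarrow> r *\<^sub>R x \<in> X"
    and c: "finite M" "M \<noteq> {}" "\<And>\<mu>. \<mu> \<in> M \<Longrightarrow> br z (c \<mu>) = \<mu> *\<^sub>R c \<mu>" "sum c M \<in> X"
  shows "c (Max M) \<in> X"
proof -
  define m where "m = Max M"
  define y where "y n = exp (- (real n * m)) *\<^sub>R exp_ad br (real n *\<^sub>R z) (sum c M)" for n
  have "y n \<in> X" for n unfolding y_def by (intro X c) simp
  moreover have "y \<longlonglongrightarrow> c m"
  proof -
    have "y = (\<lambda>n. \<Sum>\<mu>\<in>M. exp (real n * (\<mu> - m)) *\<^sub>R c \<mu>)"
    proof
      fix n
      have "exp_ad br (real n *\<^sub>R z) (c \<mu>) = exp (real n * \<mu>) *\<^sub>R c \<mu>" if "\<mu> \<in> M" for \<mu>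
        by (rule exp_ad_eigenvector) (simp add: br_simps c(3)[OF that])
      then show "y n = (\<Sum>\<mu>\<in>M. exp (real n * (\<mu> - m)) *\<^sub>R c \<mu>)"
        by (simp add: y_def linear_sum[OF exp_ad_linear] scaleR_sum_right exp_add[symmetric] algebra_simps)
    qed
    moreover have "(\<lambda>n. \<Sum>\<mu>\<in>M. exp (real n * (\<mu> - m)) *\<^sub>R c \<mu>) \<longlonglongrightarrow> (\<Sum>\<mu>\<in>M. if \<mu> = m then c m else 0)"
    proof (intro tendsto_sum)
      fix \<mu> assume "\<mu> \<in> M"
      show "(\<lambda>n. exp (real n * (\<mu> - m)) *\<^sub>R c \<mu>) \<longlonglongrightarrow> (if \<mu> = m then c m else 0)"
      proof (cases "\<mu> = m")
        case False
        then have "\<mu> < m" using \<open>\<mu> \<in> M\<close> Max_ge[OF c(1), of \<mu>] by (simp add: m_def)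
        then have "(\<lambda>n. exp (\<mu> - m) ^ n) \<longlonglongrightarrow> 0"
          by (intro LIMSEQ_power_zero) simp
        then have "(\<lambda>n. exp (real n * (\<mu> - m)) *\<^sub>R c \<mu>) \<longlonglongrightarrow> 0 *\<^sub>R c \<mu>"
          by (intro tendsto_scaleR tendsto_const) (simp add: exp_of_nat_mult)
        then show ?thesis using False by simp
      qed simp
    qed
    moreover have "(\<Sum>\<mu>\<in>M. if \<mu> = m then c m else 0) = c m"
      using c(1,2) by (simp add: m_def)
    ultimately show ?thesis by simp
  qed
  ultimately show ?thesis
    unfolding m_def using closed_sequentially[OF X(1)] by blast
qed

end

section \<open>Extremal elements in invariant cones\<close>

text \<open>A simple complex Lie algebra seen as a real one; the fixed space of \<theta> is a
  compact real form. Conjugate linearity makes multiplication by i exchange the two eigenspaces of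
  \<theta>, and \<open>norm_scl\<close> controls scalars in limits.\<close>

locale complex_cartan_algebra = cartan_lie_algebra br \<theta>
  for br :: "'v::euclidean_space \<Rightarrow> 'v \<Rightarrow> 'v" and \<theta> :: "'v \<Rightarrow> 'v" +
  fixes scl :: "complex \<Rightarrow> 'v \<Rightarrow> 'v"
  assumes simple: "simple_lie_algebra scl br"
    and scl_of_real: "scl (of_real r) x = r *\<^sub>R x"
    and \<theta>_scl: "\<theta> (scl c x) = scl (cnj c) (\<theta> x)"
    and norm_scl: "norm (scl c x) = cmod c * norm x"
begin

sublocale S: simple_lie_algebra scl br
  by (rule simple)

lemma scl_scaleR: "scl c (r *\<^sub>R x) = r *\<^sub>R scl c x"
  by (simp add: scl_of_real[symmetric] mult.commute)

lemma scl_linear: "linear (scl c)"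
  by (rule linearI) (simp_all add: S.scale_right_distrib scl_scaleR)

lemma scl_linear_left: "linear (\<lambda>c. scl c x)"
  by (rule linearI) (simp_all add: S.scale_left_distrib scl_scaleR scaleR_conv_of_real
      flip: scl_of_real)

lemma killing_scl: "killing br (scl c x) y = killing br x (scl c y)"
  by (simp add: killing_alt S.br_scale_left S.br_scale_right)

lemma group_scl: "g \<in> adjoint_group br \<Longrightarrow> g (scl c x) = scl c (g x)"
  by (rule adjoint_group_intertwine[symmetric]) (auto simp: scl_linear S.br_scale_right)

lemma exp_ad_scl:
  assumes "br h x = x"
  shows "exp_ad br (scl a h) x = scl (exp a) x"
proof (rule exp_ad_eqI)
  have "(br (scl a h) ^^ n) x = scl (a ^ n) x" for n
    by (induction n) (auto simp: S.br_scale_left S.br_scale_right assms mult.commute)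
  then have "(1 / fact n) *\<^sub>R (br (scl a h) ^^ n) x = scl (a ^ n /\<^sub>R fact n) x" for n
    by (simp add: linear_cmul[OF scl_linear_left] divide_inverse)
  then show "(\<lambda>n. (1 / fact n) *\<^sub>R (br (scl a h) ^^ n) x) sums scl (exp a) x"
    using bounded_linear.sums[OF linear_conv_bounded_linear[THEN iffD1, OF scl_linear_left]
        exp_converges[of a]] by simp
qed

text \<open>Exponentials of complex multiples of \<open>h\<close> act on \<open>x\<close> by every
  nonzero scalar, so nilpotent orbits are complex cones.\<close>

lemma orbit_scl:
  assumes "ad_nilpotent br x" "c \<noteq> 0"
  shows "scl c x \<in> adjoint_orbit br x"
proof -
  obtain h where "br h x = x" using nilpotent_in_range[OF assms(1)] .
  then have "exp_ad br (scl (Ln c) h) x = scl c x" by (simp add: exp_ad_scl assms(2))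
  then show ?thesis using orbit_group[OF exp_ad_in_group orbit_self] by metis
qed

text \<open>The vectors all of whose translates and multiples are killed by \<open>\<phi>\<close> form an ideal.\<close>

lemma functional_on_orbit:
  fixes \<phi> :: "'v \<Rightarrow> real"
  assumes "linear \<phi>" "\<phi> w \<noteq> 0" "x \<noteq> 0"
  obtains g c where "g \<in> adjoint_group br" "c \<noteq> 0" "\<phi> (scl c (g x)) \<noteq> 0"
proof -
  define W where "W = {w. \<forall>g\<in>adjoint_group br. \<forall>c. \<phi> (scl c (g w)) = 0}"
  have "lie_ideal scl br W"
    unfolding lie_ideal_def
  proof (intro conjI ballI allI)
    show "S.subspace W"
      unfolding S.subspace_def W_def
      using linear_0[OF assms(1)] linear_add[OF assms(1)]
      by (auto simp: adjoint_group_linear linear_0 linear_add S.scale_right_distrib group_scl)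
    fix x y assume y: "y \<in> W"
    show "br x y \<in> W"
      unfolding W_def
    proof (intro CollectI ballI allI)
      fix g c assume g: "g \<in> adjoint_group br"
      have "\<phi> (scl c (exp_ad br (t *\<^sub>R g x) (g y))) = 0" for t
        using y adjoint_group.intros(2)[OF g, of "t *\<^sub>R g x"] by (auto simp: W_def)
      then have "\<phi> (scl c (br (g x) (g y))) = 0"
        using exp_ad_derivative_vanishes[of "\<lambda>v. \<phi> (scl c v)" "g x" "g y"]
          linear_compose[OF scl_linear[of c] assms(1)] by (simp add: comp_def)
      then show "\<phi> (scl c (g (br x y))) = 0" by (simp add: adjoint_group_br[OF g])
    qed
  qed
  then have "W = {0} \<or> W = UNIV" by (rule S.ideals_trivial)
  moreover have "w \<notin> W"
    unfolding W_def using assms(2) adjoint_group.intros(1)[of br]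
    by (auto intro!: bexI[of _ id] exI[of _ 1])
  ultimately have "x \<notin> W" using assms(3) by blast
  then obtain g c where gc: "g \<in> adjoint_group br" "\<phi> (scl c (g x)) \<noteq> 0" by (auto simp: W_def)
  moreover have "c \<noteq> 0" using gc(2) linear_0[OF assms(1)] by auto
  ultimately show ?thesis using that by blast
qed

section \<open>Extremal elements and their stability\<close>

definition extremal :: "'v \<Rightarrow> bool" where
  "extremal x \<longleftrightarrow> (\<forall>y. \<exists>c. br x (br x y) = scl c x)"

lemma extremal_nilpotent:
  assumes "extremal x"
  shows "ad_nilpotent br x"
proof -
  have "(br x ^^ 3) y = 0" for y
  proof -
    obtain c where "br x (br x y) = scl c x" using assms by (auto simp: extremal_def)
    then show ?thesis by (simp add: numeral_3_eq_3 S.br_scale_right)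
  qed
  then show ?thesis by (auto simp: ad_nilpotent_def)
qed

lemma extremal_group:
  assumes "g \<in> adjoint_group br" "extremal x"
  shows "extremal (g x)"
  unfolding extremal_def
proof
  fix y
  obtain h where h: "\<And>z. g (h z) = z" using adjoint_group_inverse[OF assms(1)] by metis
  obtain c where "br x (br x (h y)) = scl c x" using assms(2) by (auto simp: extremal_def)
  then have "g (br x (br x (h y))) = g (scl c x)" by simp
  then show "\<exists>c. br (g x) (br (g x) y) = scl c (g x)"
    by (auto simp: adjoint_group_br[OF assms(1)] group_scl[OF assms(1)] h)
qed

lemma extremal_scl:
  assumes "extremal x"
  shows "extremal (scl d x)"
  unfolding extremal_def
proof
  fix y
  obtain c where "br x (br x y) = scl c x" using assms by (auto simp: extremal_def)
  then have "br (scl d x) (br (scl d x) y) = scl (d * c) (scl d x)"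
    by (simp add: S.br_scale_left S.br_scale_right mult.commute mult.left_commute)
  then show "\<exists>c. br (scl d x) (br (scl d x) y) = scl c (scl d x)" ..
qed

lemma extremal_\<theta>:
  assumes "extremal x"
  shows "extremal (\<theta> x)"
  unfolding extremal_def
proof
  fix y
  obtain c where "br x (br x (\<theta> y)) = scl c x" using assms by (auto simp: extremal_def)
  then have "\<theta> (br x (br x (\<theta> y))) = \<theta> (scl c x)" by simp
  then show "\<exists>c. br (\<theta> x) (br (\<theta> x) y) = scl c (\<theta> x)" by (auto simp: \<theta>_br \<theta>_scl)
qed

text \<open>Along a convergent sequence of extremal elements the moduli of the scalars are quotients
  of norms whose denominators tend to \<open>norm x\<close>, which is nonzero. The scalars are
  therefore bounded, and a convergent subsequence provides the scalar for \<open>x\<close>.\<close>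

lemma extremal_closure:
  assumes "x \<in> closure {x. extremal x}" "x \<noteq> 0"
  shows "extremal x"
  unfolding extremal_def
proof
  fix y
  obtain s where s: "\<And>n. extremal (s n)" "s \<longlonglongrightarrow> x"
    using assms(1) by (auto simp: closure_sequential)
  then have "\<exists>c. \<forall>n. br (s n) (br (s n) y) = scl (c n) (s n)"
    by (intro choice) (auto simp: extremal_def)
  then obtain c where c: "\<And>n. br (s n) (br (s n) y) = scl (c n) (s n)" by blast
  have lim: "(\<lambda>n. br (s n) (br (s n) y)) \<longlonglongrightarrow> br x (br x y)"
    by (intro bounded_bilinear.tendsto[OF bilinear_conv_bounded_bilinear[THEN iffD1, OF br_bilinear]]
        s(2) tendsto_const)
  have "(\<lambda>n. cmod (c n)) \<longlonglongrightarrow> norm (br x (br x y)) / norm x"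
  proof (rule Lim_transform_eventually)
    show "(\<lambda>n. norm (br (s n) (br (s n) y)) / norm (s n)) \<longlonglongrightarrow> norm (br x (br x y)) / norm x"
      by (intro tendsto_intros lim s(2)) (simp add: assms(2))
    have "eventually (\<lambda>n. s n \<noteq> 0) sequentially"
      using s(2) assms(2) by (rule tendsto_imp_eventually_ne)
    then show "eventually (\<lambda>n. norm (br (s n) (br (s n) y)) / norm (s n) = cmod (c n)) sequentially"
      by eventually_elim (simp add: c norm_scl)
  qed
  then have "bounded (range c)"
    using convergent_imp_bounded[of "\<lambda>n. cmod (c n)"] by (auto simp: bounded_iff)
  then obtain l r where r: "strict_mono (r :: nat \<Rightarrow> nat)" "(c \<circ> r) \<longlonglongrightarrow> l"
    using bounded_imp_convergent_subsequence by blast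
  have "bounded_bilinear scl"
    by (intro bilinear_conv_bounded_bilinear[THEN iffD1])
      (auto simp: bilinear_def scl_linear scl_linear_left)
  then have "(\<lambda>n. scl ((c \<circ> r) n) ((s \<circ> r) n)) \<longlonglongrightarrow> scl l x"
    by (rule bounded_bilinear.tendsto) (use r s(2) LIMSEQ_subseq_LIMSEQ in blast)+
  moreover have "(\<lambda>n. scl ((c \<circ> r) n) ((s \<circ> r) n)) \<longlonglongrightarrow> br x (br x y)"
    using LIMSEQ_subseq_LIMSEQ[OF lim r(1)] by (simp add: c comp_def)
  ultimately have "br x (br x y) = scl l x" using LIMSEQ_unique by blast
  then show "\<exists>c. br x (br x y) = scl c x" ..
qed

text \<open>Covers the closures of nilpotent orbits and also the whole space, so that one
  construction of extremal elements serves both.\<close>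

definition invariant_cone :: "'v set \<Rightarrow> bool" where
  "invariant_cone X \<longleftrightarrow> closed X \<and> (\<forall>g\<in>adjoint_group br. g ` X \<subseteq> X) \<and> (\<forall>c. c \<noteq> 0 \<longrightarrow> scl c ` X \<subseteq> X)"

lemma invariant_coneD:
  assumes "invariant_cone X"
  shows "closed X" "x \<in> X \<Longrightarrow> exp_ad br z x \<in> X" "x \<in> X \<Longrightarrow> c \<noteq> 0 \<Longrightarrow> scl c x \<in> X"
    "x \<in> X \<Longrightarrow> r > 0 \<Longrightarrow> r *\<^sub>R x \<in> X" "x \<in> X \<Longrightarrow> g \<in> adjoint_group br \<Longrightarrow> g x \<in> X"
  using assms exp_ad_in_group[of z] scl_of_real[of r x]
  unfolding invariant_cone_def by (auto, (metis image_subset_iff of_real_eq_0_iff less_irrefl)+)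

text \<open>The given \<open>v\<close> need not lie in the cone. Simplicity moves \<open>x\<close>
  within the cone to a vector that is not orthogonal to \<open>v\<close>; such a vector has a
  nonzero component of eigenvalue \<open>N\<close>, and the flow of ad h isolates it.\<close>

lemma invariant_cone_top_eigenvector:
  assumes X: "invariant_cone X" "x \<in> X" "x \<noteq> 0"
    and h: "\<theta> h = - h" "br h v = N *\<^sub>R v" "v \<noteq> 0" "\<And>y. B (br h y) y \<le> N * B y y"
  obtains w where "w \<in> X" "w \<noteq> 0" "br h w = N *\<^sub>R w"
proof -
  have "linear (\<lambda>w. B w v)" by (rule linearI) (simp_all add: B_simps)
  then obtain g a where g: "g \<in> adjoint_group br" "a \<noteq> 0" "B (scl a (g x)) v \<noteq> 0"
    using functional_on_orbit[of "\<lambda>w. B w v" v x] h(3) X(3) by auto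
  define w where "w = scl a (g x)"
  have wX: "w \<in> X" unfolding w_def using invariant_coneD[OF X(1)] X(2) g by blast
  obtain M c where M: "finite M" "\<And>\<mu>. \<mu> \<in> M \<Longrightarrow> br h (c \<mu>) = \<mu> *\<^sub>R c \<mu>"
    "\<And>\<mu>. \<mu> \<in> M \<Longrightarrow> c \<mu> \<noteq> 0" "w = sum c M"
    using eigenvector_decomposition[OF br_linear B_br_p[OF h(1)], of w] by metis
  have le: "\<mu> \<le> N" if "\<mu> \<in> M" for \<mu>
  proof -
    have "\<mu> * B (c \<mu>) (c \<mu>) \<le> N * B (c \<mu>) (c \<mu>)"
      using h(4)[of "c \<mu>"] M(2)[OF that] by (simp add: B_simps)
    then show ?thesis using B_pos[OF M(3)[OF that]] by simp
  qed
  have "N \<in> M"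
  proof (rule ccontr)
    assume "N \<notin> M"
    then have "B (c \<mu>) v = 0" if "\<mu> \<in> M" for \<mu>
      using eigenvectors_orthogonal[of "br h", OF B_br_p[OF h(1)] M(2)[OF that] h(2)] that by blast
    then show False using g(3) by (simp add: w_def[symmetric] M(4) B_sum_left)
  qed
  then have "Max M = N" using le M(1) by (intro Max_eqI)
  then have "c N \<in> X"
    using exp_limit_component[of X h M c] invariant_coneD[OF X(1)] M(1,2,4) wX \<open>N \<in> M\<close> by auto
  then show ?thesis using that M(2,3) \<open>N \<in> M\<close> by blast
qed

text \<open>A nonzero \<open>h\<close> in the (-1)-eigenspace is i x or x - \<theta> x. Definiteness
  of \<open>B\<close> keeps ad h from vanishing, and symmetry of the spectrum under \<theta> allows
  the sign of a nonzero eigenvalue to be chosen.\<close>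

lemma exists_p_positive_eigenvalue:
  obtains h N v where "\<theta> h = - h" "br h v = N *\<^sub>R v" "v \<noteq> 0" "N > 0" "\<And>y. B (br h y) y \<le> N * B y y"
proof -
  obtain x y where "br x y \<noteq> 0" using S.nonabelian by blast
  then have "x \<noteq> 0" by (auto simp: br_simps)
  have "\<exists>h. \<theta> h = - h \<and> h \<noteq> 0"
  proof (cases "\<theta> x = x")
    case True
    then have "\<theta> (scl \<i> x) = - scl \<i> x" by (simp add: \<theta>_scl)
    moreover have "scl \<i> x \<noteq> 0" using \<open>x \<noteq> 0\<close> by simp
    ultimately show ?thesis by blast
  next
    case False
    then show ?thesis by (intro exI[of _ "x - \<theta> x"]) (simp add: \<theta>_simps)
  qed
  then obtain h where h: "\<theta> h = - h" "h \<noteq> 0" by blast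
  have "\<exists>y. br h y \<noteq> 0"
  proof (rule ccontr)
    assume "\<nexists>y. br h y \<noteq> 0"
    then have "killing br h (\<theta> h) = 0" by (simp add: killing_alt)
    then show False using B_pos[OF h(2)] by (simp add: B_def)
  qed
  then obtain y where y: "br h y \<noteq> 0" by blast
  obtain M c where M: "finite M" "\<And>\<mu>. \<mu> \<in> M \<Longrightarrow> br h (c \<mu>) = \<mu> *\<^sub>R c \<mu>"
    "\<And>\<mu>. \<mu> \<in> M \<Longrightarrow> c \<mu> \<noteq> 0" "y = sum c M"
    using eigenvector_decomposition[OF br_linear B_br_p[OF h(1)], of y] by metis
  have "\<exists>\<mu>\<in>M. \<mu> \<noteq> 0"
  proof (rule ccontr)
    assume "\<not> (\<exists>\<mu>\<in>M. \<mu> \<noteq> 0)"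
    then have "br h y = 0" unfolding M(4) br_sum_right using M(2) by (intro sum.neutral) auto
    then show False using y by simp
  qed
  then obtain \<mu> where \<mu>: "\<mu> \<in> M" "\<mu> \<noteq> 0" by blast
  have "br h (\<theta> (c \<mu>)) = - \<mu> *\<^sub>R \<theta> (c \<mu>)" by (rule \<theta>_eigenvector[OF h(1) M(2)[OF \<mu>(1)]])
  then have "\<exists>u. u \<noteq> 0 \<and> br h u = \<bar>\<mu>\<bar> *\<^sub>R u"
    using M(2,3)[OF \<mu>(1)] by (cases "\<mu> \<ge> 0") (auto intro: exI[of _ "c \<mu>"] exI[of _ "\<theta> (c \<mu>)"])
  then obtain u where u: "u \<noteq> 0" "br h u = \<bar>\<mu>\<bar> *\<^sub>R u" by blast
  obtain N v where v: "v \<noteq> 0" "br h v = N *\<^sub>R v" "\<And>y. B (br h y) y \<le> N * B y y"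
    using top_eigenvector[of UNIV "br h"] br_linear B_br_p[OF h(1)] u(1) subspace_UNIV
    by (metis UNIV_I singletonD)
  have "\<bar>\<mu>\<bar> * B u u \<le> N * B u u" using v(3)[of u] u(2) by (simp add: B_simps)
  then have "N > 0" using B_pos[OF u(1)] \<mu>(2) by simp
  then show ?thesis using that h(1) v by blast
qed

lemma mu_continuous_on: "continuous_on T mu"
  unfolding mu_def
  by (intro continuous_on_minus br_continuous_on continuous_on_id linear_continuous_on
      linear_conv_bounded_linear[THEN iffD1] \<theta>_linear)

text \<open>Maximising the norm of the moment map \<open>mu\<close> over the projectivised cone yields a vector of the
  highest root space of \<open>h = mu e\<close>.\<close>

lemma invariant_cone_maximal_mu:
  assumes X: "invariant_cone X" "x \<in> X" "x \<noteq> 0"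
  obtains e where "e \<in> X" "B e e = 1" "mu e \<noteq> 0"
    "\<And>w. w \<in> X \<Longrightarrow> B w w = 1 \<Longrightarrow> B (mu w) (mu w) \<le> B (mu e) (mu e)"
proof -
  \<comment> \<open>Numerator and denominator both have degree 4, so \<open>F\<close> is constant on
    positive rays and its maximum over the cone is attained on the compact slice
    \<open>K\<close>.\<close>
  define F where "F w = B (mu w) (mu w) / (B w w)\<^sup>2" for w
  define K where "K = X \<inter> sphere 0 1"
  have F_scaleR: "F (r *\<^sub>R w) = F w" if "r > 0" for r w
    using that by (simp add: F_def mu_scaleR B_simps power2_eq_square)
  \<comment> \<open>Excludes the maximum 0: a vector of the cone with positive ad h-eigenvalue pairs
    positively with \<open>h\<close> under the moment map.\<close>
  have nonzero: "\<exists>w. w \<in> X \<and> w \<noteq> 0 \<and> F w > 0"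
  proof -
    obtain h N v where h: "\<theta> h = - h" "br h v = N *\<^sub>R v" "v \<noteq> 0" "N > 0"
      "\<And>y. B (br h y) y \<le> N * B y y"
      by (rule exists_p_positive_eigenvalue) (rule that)
    obtain w where w: "w \<in> X" "w \<noteq> 0" "br h w = N *\<^sub>R w"
      by (rule invariant_cone_top_eigenvector[OF X h(1,2,3,5)])
    have "B h (mu w) = N * B w w" using B_mu[of h w] w(3) by (simp add: B_simps)
    then have "mu w \<noteq> 0" using h(4) B_pos[OF w(2)] by (auto simp: B_simps)
    then have "F w > 0"
      unfolding F_def by (intro divide_pos_pos zero_less_power B_pos w(2))
    then show ?thesis using w by blast
  qed
  have "compact K"
    unfolding K_def using invariant_coneD(1)[OF X(1)] by (intro closed_Int_compact) auto
  moreover have normalize: "(1 / norm w) *\<^sub>R w \<in> K" if "w \<in> X" "w \<noteq> 0" for w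
    using that invariant_coneD(4)[OF X(1)] by (simp add: K_def)
  moreover have "continuous_on K F"
    unfolding F_def
    by (intro continuous_on_divide B_continuous_on continuous_on_power mu_continuous_on
        continuous_on_id) (auto simp: K_def)
  ultimately obtain e0 where e0: "e0 \<in> K" "\<And>w. w \<in> K \<Longrightarrow> F w \<le> F e0"
    using continuous_attains_sup[of K F] X by blast
  have max: "F w \<le> F e0" if "w \<in> X" "w \<noteq> 0" for w
    using e0(2)[OF normalize[OF that]] F_scaleR[of "1 / norm w" w] that by simp
  have e0X: "e0 \<in> X" "e0 \<noteq> 0" using e0(1) by (auto simp: K_def)
  define r where "r = 1 / sqrt (B e0 e0)"
  define e where "e = r *\<^sub>R e0"
  have r: "r > 0" using B_pos[OF e0X(2)] by (simp add: r_def)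
  have e: "e \<in> X" "B e e = 1" "F e = F e0"
    using e0X r invariant_coneD(4)[OF X(1)] B_pos[OF e0X(2)] F_scaleR
    by (auto simp: e_def r_def B_simps)
  have "F e > 0" using nonzero max e(3) by fastforce
  then have "mu e \<noteq> 0" by (auto simp: F_def B_simps)
  moreover have "B (mu w) (mu w) \<le> B (mu e) (mu e)" if "w \<in> X" "B w w = 1" for w
  proof -
    have "w \<noteq> 0" using that(2) by (auto simp: B_simps)
    then have "F w \<le> F e" using max[OF that(1)] e(3) by simp
    then show ?thesis using that(2) e(2) by (simp add: F_def)
  qed
  ultimately show ?thesis using that e by blast
qed

text \<open>Extremality comes down to one fact: the top eigenspace of ad h is a single complex line.
  Maximality forces it, because top vectors inside the cone share one moment direction, which leaves
  the centralizer of \<open>h\<close> no freedom in acting on \<open>e\<close>.\<close>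

lemma invariant_cone_contains_extremal:
  assumes X: "invariant_cone X" "x \<in> X" "x \<noteq> 0"
  obtains e N where "e \<in> X" "e \<noteq> 0" "extremal e" "N > 0" "br (mu e) e = N *\<^sub>R e"
proof -
  obtain e0 where e0: "e0 \<in> X" "B e0 e0 = 1" "mu e0 \<noteq> 0"
    "\<And>w. w \<in> X \<Longrightarrow> B w w = 1 \<Longrightarrow> B (mu w) (mu w) \<le> B (mu e0) (mu e0)"
    using invariant_cone_maximal_mu[OF X] by metis
  define h where "h = mu e0"
  have h: "\<theta> h = - h" "h \<noteq> 0" by (simp_all add: h_def \<theta>_mu e0)
  obtain N v where v: "v \<noteq> 0" "br h v = N *\<^sub>R v" "\<And>y. B (br h y) y \<le> N * B y y"
    using top_eigenvector[of UNIV "br h"] br_linear B_br_p[OF h(1)] h(2) subspace_UNIV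
    by (metis UNIV_I singletonD)
  have "B h h \<le> N" using v(3)[of e0] B_mu[of h e0] e0(2) by (simp add: h_def)
  then have N: "N > 0" using B_pos[OF h(2)] by linarith
  \<comment> \<open>\<open>B h (mu w) = N\<close> is at least \<open>B h h\<close>, and by
    maximality \<open>B h h\<close> is at least \<open>B (mu w) (mu w)\<close>. Expanding the
    squared distance of \<open>mu w\<close> from \<open>h\<close> leaves nothing positive.\<close>
  have rigid: "mu w = h" if w: "w \<in> X" "B w w = 1" "br h w = N *\<^sub>R w" for w
  proof -
    have "B h (mu w) = N" using B_mu[of h w] w by (simp add: B_simps)
    then have "B (mu w - h) (mu w - h) = B (mu w) (mu w) - 2 * N + B h h"
      by (simp add: B_simps B_sym[of "mu w" h])
    then have "B (mu w - h) (mu w - h) \<le> 0"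
      using e0(4)[OF w(1,2)] \<open>B h h \<le> N\<close> by (simp add: h_def)
    then show ?thesis using B_pos[of "mu w - h"] by (cases "mu w - h = 0") auto
  qed
  have rigid': "mu w = B w w *\<^sub>R h" if w: "w \<in> X" "w \<noteq> 0" "br h w = N *\<^sub>R w" for w
  proof -
    define r where "r = 1 / sqrt (B w w)"
    have r: "r > 0" "r\<^sup>2 * B w w = 1"
      using B_pos[OF w(2)] w(2) by (simp_all add: r_def power_divide)
    have "mu (r *\<^sub>R w) = h"
      using r w invariant_coneD(4)[OF X(1)]
      by (intro rigid) (auto simp: B_simps br_simps power2_eq_square)
    then have "r\<^sup>2 *\<^sub>R mu w = r\<^sup>2 *\<^sub>R (B w w *\<^sub>R h)" using r(2) by (simp add: mu_scaleR)
    then show ?thesis using r(1) by (simp del: scaleR_scaleR)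
  qed
  obtain e1 where e1: "e1 \<in> X" "e1 \<noteq> 0" "br h e1 = N *\<^sub>R e1"
    by (rule invariant_cone_top_eigenvector[OF X h(1) v(2,1,3)])
  \<comment> \<open>\<open>e\<close> takes over from the maximizer \<open>e0\<close>: by
    \<open>rigid\<close> it has the same moment image, and it is an eigenvector for it.\<close>
  define e where "e = (1 / sqrt (B e1 e1)) *\<^sub>R e1"
  have e: "e \<in> X" "e \<noteq> 0" "br h e = N *\<^sub>R e" "B e e = 1"
    using e1 B_pos[OF e1(2)] invariant_coneD(4)[OF X(1)]
    by (auto simp: e_def br_simps B_simps)
  have mu_e: "mu e = h" using rigid e by blast
  \<comment> \<open>Stable under exp (t ad z) for \<open>z\<close> centralizing \<open>h\<close> and
    under positive scaling, which is all that \<open>exp_limit_component\<close> asks for.\<close>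
  define X' where "X' = X \<inter> {w. br h w = N *\<^sub>R w}"
  have X'_closed: "closed X'"
    unfolding X'_def using invariant_coneD(1)[OF X(1)]
    by (intro closed_Int closed_Collect_eq linear_continuous_on[unfolded continuous_on_eq_continuous_within]
        br_continuous_on continuous_intros) auto
  text \<open>Along \<open>exp (t ad z) e\<close> the moment map does not change direction, so that \<open>e\<close> has only one
    component with respect to \<open>ad z\<close>.\<close>
  have p_scalar: "\<exists>m. br z e = m *\<^sub>R e" if z: "\<theta> z = - z" "br h z = 0" for z
  proof -
    have comm: "br h (br z w) = br z (br h w)" for w
      using br_leibniz[of h z w] z(2) by (simp add: br_simps)
    have X': "exp_ad br (t *\<^sub>R z) w \<in> X'" "r > 0 \<Longrightarrow> r *\<^sub>R w \<in> X'" if "w \<in> X'" for t r w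
      using that invariant_coneD[OF X(1)]
        exp_ad_intertwine[OF br_linear, of h "t *\<^sub>R z" w]
      by (auto simp: X'_def br_simps comm linear_cmul[OF exp_ad_linear])
    have eX': "e \<in> X'" using e by (simp add: X'_def)
    obtain M c where M: "finite M" "\<And>\<mu>. \<mu> \<in> M \<Longrightarrow> br z (c \<mu>) = \<mu> *\<^sub>R c \<mu>"
      "\<And>\<mu>. \<mu> \<in> M \<Longrightarrow> c \<mu> \<noteq> 0" "e = sum c M"
      using eigenvector_decomposition[OF br_linear B_br_p[OF z(1)], of e] by metis
    have "M \<noteq> {}" using M(4) e(2) by auto
    \<comment> \<open>The moment image of such a component is a multiple of \<open>h\<close> by
      \<open>rigid'\<close>, and this determines its ad z-eigenvalue.\<close>
    have val: "\<mu> = B z h" if "\<mu> \<in> M" "c \<mu> \<in> X'" for \<mu>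
    proof -
      have "\<mu> * B (c \<mu>) (c \<mu>) = B z (mu (c \<mu>))"
        using B_mu[of z "c \<mu>"] M(2)[OF that(1)] by (simp add: B_simps)
      also have "\<dots> = B z h * B (c \<mu>) (c \<mu>)"
        using rigid'[of "c \<mu>"] that M(3)[OF that(1)] by (simp add: X'_def B_simps)
      finally show ?thesis using M(3)[OF that(1)] by simp
    qed
    have "c (Max M) \<in> X'"
      using exp_limit_component[of X' z M c] X'_closed X' M \<open>M \<noteq> {}\<close> eX' by auto
    then have max: "Max M = B z h" using val M(1) \<open>M \<noteq> {}\<close> Max_in by blast
    \<comment> \<open>Replacing \<open>z\<close> by \<open>- z\<close> turns the least eigenvalue
      into the greatest, so both ends of \<open>M\<close> equal \<open>B z h\<close>.\<close>
    define M' where "M' = uminus ` M"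
    have M': "finite M'" "M' \<noteq> {}" using M(1) \<open>M \<noteq> {}\<close> by (auto simp: M'_def)
    have "sum (\<lambda>\<mu>. c (- \<mu>)) M' = e"
      unfolding M'_def M(4) by (subst sum.reindex) (auto simp: inj_on_def)
    then have sum': "sum (\<lambda>\<mu>. c (- \<mu>)) M' \<in> X'" using eX' by simp
    have X'_neg: "exp_ad br (t *\<^sub>R (- z)) w \<in> X'" if "w \<in> X'" for t w
      using X'(1)[OF that, of "- t"] by simp
    have eig': "br (- z) (c (- \<mu>)) = \<mu> *\<^sub>R c (- \<mu>)" if "\<mu> \<in> M'" for \<mu>
      using M(2)[of "- \<mu>"] that by (auto simp: M'_def br_simps)
    have "c (- Max M') \<in> X'"
      by (rule exp_limit_component[of X' "- z" M' "\<lambda>\<mu>. c (- \<mu>)",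
            OF X'_closed X'_neg X'(2) M' eig' sum'])
    moreover have "- Max M' \<in> M" using Max_in[OF M'] by (auto simp: M'_def)
    ultimately have min: "- Max M' = B z h" using val by blast
    have "\<mu> = B z h" if "\<mu> \<in> M" for \<mu>
      using Max_ge[OF M(1) that] Max_ge[OF M'(1), of "- \<mu>"] that max min by (auto simp: M'_def)
    then have "M = {B z h}" using \<open>M \<noteq> {}\<close> by blast
    then show ?thesis using M(2,4) by auto
  qed
  \<comment> \<open>Write \<open>y = z1 + scl \<i> z2\<close> with both parts in the
    (-1)-eigenspace: multiplication by -i carries the \<theta>-fixed part there.\<close>
  have centralizer_scalar: "\<exists>m. br y e = scl m e" if y: "br h y = 0" for y
  proof -
    define z1 where "z1 = (1 / 2) *\<^sub>R (y - \<theta> y)"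
    define z2 where "z2 = scl (- \<i>) ((1 / 2) *\<^sub>R (y + \<theta> y))"
    have "br h (\<theta> y) = 0" using \<theta>_eigenvector[OF h(1), of y 0] y by simp
    then have "br h z1 = 0" "br h z2 = 0"
      by (simp_all add: z1_def z2_def br_simps y S.br_scale_right)
    moreover have "\<theta> z1 = - z1" "\<theta> z2 = - z2"
      by (simp_all add: z1_def z2_def \<theta>_simps \<theta>_scl add.commute flip: scaleR_minus_right)
    ultimately obtain m1 m2 where m: "br z1 e = m1 *\<^sub>R e" "br z2 e = m2 *\<^sub>R e"
      using p_scalar by metis
    have "y = z1 + scl \<i> z2"
      by (simp add: z1_def z2_def flip: scaleR_add_right)
    then have "br y e = scl (of_real m1 + \<i> * of_real m2) e"
      by (simp add: br_simps S.br_scale_left m S.scale_left_distrib flip: scl_of_real)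
    then show ?thesis by blast
  qed
  \<comment> \<open>\<open>br e w\<close> would have eigenvalue \<open>N + N\<close>, beyond the
    maximum. The Leibniz rule then gives \<open>br e (br w (\<theta> e)) = N *\<^sub>R w\<close>,
    while \<open>br w (\<theta> e)\<close> centralizes \<open>h\<close> and so acts on
    \<open>e\<close> by a scalar.\<close>
  have top_line: "\<exists>c. w = scl c e" if w: "br h w = N *\<^sub>R w" for w
  proof -
    have "br e w = 0"
    proof (rule ccontr)
      assume "br e w \<noteq> 0"
      have "br h (br e w) = (N + N) *\<^sub>R br e w" by (rule br_eigenvectors[OF e(3) w])
      then have "(N + N) * B (br e w) (br e w) \<le> N * B (br e w) (br e w)"
        using v(3)[of "br e w"] by (simp add: B_simps del: mult_le_cancel_right)
      then show False using N B_pos[OF \<open>br e w \<noteq> 0\<close>] by (simp add: algebra_simps mult_le_0_iff)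
    qed
    have "br h (br w (\<theta> e)) = 0"
      using br_eigenvectors[OF w \<theta>_eigenvector[OF h(1) e(3)]] by simp
    then obtain m where m: "br (br w (\<theta> e)) e = scl m e" using centralizer_scalar by blast
    have "br e (\<theta> e) = - h" unfolding mu_e[symmetric] by (simp add: mu_def)
    then have "br e (br w (\<theta> e)) = N *\<^sub>R w"
      using br_leibniz[of e w "\<theta> e"] \<open>br e w = 0\<close> br_skew[of w h] w
      by (simp add: br_simps)
    then have "scl m e = - N *\<^sub>R w" using m br_skew[of "br w (\<theta> e)" e] by simp
    then have "w = scl (of_real (- 1 / N)) (scl m e)" using N by (simp only: scl_of_real) simp
    then show ?thesis by (metis S.scale_scale)
  qed
  have "extremal e"
    unfolding extremal_def
  proof
    fix y
    obtain M c where M: "finite M" "\<And>\<mu>. \<mu> \<in> M \<Longrightarrow> br h (c \<mu>) = \<mu> *\<^sub>R c \<mu>"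
      "\<And>\<mu>. \<mu> \<in> M \<Longrightarrow> c \<mu> \<noteq> 0" "y = sum c M"
      using eigenvector_decomposition[OF br_linear B_br_p[OF h(1)], of y] by metis
    have bound: "\<mu> \<le> N" if "br h u = \<mu> *\<^sub>R u" "u \<noteq> 0" for u \<mu>
      using v(3)[of u] that(1) B_pos[OF that(2)] by (simp add: B_simps)
    \<comment> \<open>The spectrum of ad h lies between \<open>- N\<close> and \<open>N\<close> and
      ad e raises by \<open>N\<close>, so only the component at \<open>- N\<close> can survive
      twice, and it lands at \<open>N\<close>.\<close>
    have "br h (br e (br e (c \<mu>))) = N *\<^sub>R br e (br e (c \<mu>))" if \<mu>: "\<mu> \<in> M" for \<mu>
    proof (cases "br e (br e (c \<mu>)) = 0")
      case False
      have *: "br h (br e (br e (c \<mu>))) = (N + (N + \<mu>)) *\<^sub>R br e (br e (c \<mu>))"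
        by (intro br_eigenvectors e M(2)[OF \<mu>])
      have "N + (N + \<mu>) \<le> N" by (rule bound[OF * False])
      moreover have "- \<mu> \<le> N"
        by (rule bound[OF \<theta>_eigenvector[OF h(1) M(2)[OF \<mu>]]]) (simp add: M(3)[OF \<mu>])
      ultimately have "\<mu> = - N" by linarith
      then show ?thesis using * by simp
    qed (simp add: br_simps)
    then have "br h (br e (br e y)) = N *\<^sub>R br e (br e y)"
      by (simp add: M(4) br_sum_right scaleR_sum_right)
    then show "\<exists>c. br e (br e y) = scl c e" by (rule top_line)
  qed
  then show ?thesis using that e N mu_e by metis
qed

end

section \<open>The minimal nilpotent orbit\<close>

context complex_cartan_algebra
begin

lemma killing_ad_skew: "killing br (br f x) y = - killing br x (br f y)"
  using killing_invariant[of x f y] br_skew[of f x] by (simp add: killing_simps)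

text \<open>Both pairs \<open>(e, f)\<close> and \<open>(y, f)\<close>, suitably scaled, belong to \<open>sl\<^sub>2\<close>-triples with the same \<open>f\<close>.
  The difference \<open>v\<close> of the semisimple elements \<open>h'\<close> and \<open>h\<close> is a sum of \<open>ad h\<close>-eigenvectors for \<open>-1\<close> and
  \<open>-2\<close> centralizing \<open>f\<close>, so that a single exponential of an element of the centralizer of \<open>f\<close> maps \<open>h\<close>
  to \<open>h'\<close>.\<close>

lemma extremal_conjugate_aux:
  assumes ef: "br e f = h" "br h e = 2 *\<^sub>R e" "br h f = - 2 *\<^sub>R f"
    and f: "extremal f"
    and weight2: "\<And>z. br h z = 2 *\<^sub>R z \<Longrightarrow> \<exists>c. z = scl c e"
    and weight_minus2: "\<And>z. br h z = - 2 *\<^sub>R z \<Longrightarrow> \<exists>c. z = scl c f"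
    and y: "extremal y" "killing br y f \<noteq> 0"
  obtains g c where "g \<in> adjoint_group br" "y = scl c (g e)"
proof -
  obtain \<beta> where \<beta>: "br f (br f y) = scl \<beta> f" using f by (auto simp: extremal_def)
  obtain \<alpha> where \<alpha>: "br y (br y f) = scl \<alpha> y" using y(1) by (auto simp: extremal_def)
  have fe: "br f e = - h" using ef(1) br_skew by metis
  have fh: "br f h = 2 *\<^sub>R f" using ef(3) br_skew[of f h] by simp
  have ffe: "br f (br f e) = - 2 *\<^sub>R f" by (simp add: fe fh br_simps)
  have "killing br (scl \<beta> f) e = - 2 * killing br y f"
    unfolding \<beta>[symmetric] killing_ad_skew ffe by (simp add: killing_simps killing_ad_skew ffe)
  then have \<beta>0: "\<beta> \<noteq> 0" using y(2) by (auto simp: killing_simps)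
  \<comment> \<open>Both sides compute killing ([y,f], [y,f]) up to sign. The Killing form over the
    reals sees a complex scalar only through a real part, hence the free factor \<open>d\<close>,
    chosen in the end with \<open>d * (\<alpha> - \<beta>) = 1\<close>.\<close>
  have "\<alpha> = \<beta>"
  proof (rule ccontr)
    assume neq: "\<alpha> \<noteq> \<beta>"
    have eq: "killing br (scl (d * \<alpha>) y) f = killing br (scl (d * \<beta>) y) f" for d
    proof -
      have "killing br (scl (d * \<alpha>) y) f = killing br (br y (br y f)) (scl d f)"
        by (simp add: \<alpha> killing_scl mult.commute flip: killing_scl[of _ f])
      also have "\<dots> = - killing br (br y f) (br y (scl d f))" by (rule killing_ad_skew)
      also have "\<dots> = - killing br (br f y) (br f (scl d y))"
        by (simp add: S.br_scale_right br_skew[of y f] S.scale_minus_right killing_simps)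
      also have "\<dots> = killing br (br f (br f y)) (scl d y)" by (simp only: killing_ad_skew minus_minus)
      also have "\<dots> = killing br (scl (d * \<beta>) y) f"
        by (simp add: \<beta> killing_sym[of _ f] killing_scl mult.commute)
      finally show ?thesis .
    qed
    define d where "d = 1 / (\<alpha> - \<beta>)"
    have "d * \<alpha> - d * \<beta> = 1" using neq by (simp add: d_def flip: diff_divide_distrib)
    then have "killing br (scl (d * \<alpha>) y) f - killing br (scl (d * \<beta>) y) f = killing br y f"
      by (simp flip: S.scale_left_diff_distrib killing_simps(3))
    then show False using eq y(2) by simp
  qed
  \<comment> \<open>Scaled so that ad f applied twice gives \<open>- 2 *\<^sub>R f\<close>, exactly
    as for \<open>e\<close>; hence their difference \<open>p\<close> below is killed by the square
    of ad f.\<close>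
  define y1 where "y1 = scl (- 2 / \<beta>) y"
  have minus2: "scl (- 2) w = - 2 *\<^sub>R w" for w using scl_of_real[of "- 2" w] by simp
  have ffy1: "br f (br f y1) = - 2 *\<^sub>R f"
  proof -
    have "br f (br f y1) = scl (- 2 / \<beta> * \<beta>) f"
      by (simp only: y1_def S.br_scale_right \<beta> S.scale_scale)
    also have "- 2 / \<beta> * \<beta> = - 2" using \<beta>0 by simp
    finally show ?thesis by (simp only: minus2)
  qed
  have y1y1f: "br y1 (br y1 f) = - 2 *\<^sub>R y1"
  proof -
    have "br y1 (br y1 f) = scl (- 2 / \<beta> * \<beta>) y1"
      by (simp only: y1_def S.br_scale_right S.br_scale_left \<alpha> S.scale_scale \<open>\<alpha> = \<beta>\<close>)
        (simp add: mult.commute mult.left_commute)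
    also have "- 2 / \<beta> * \<beta> = - 2" using \<beta>0 by simp
    finally show ?thesis by (simp only: minus2)
  qed
  define h' where "h' = br y1 f"
  have h'y1: "br h' y1 = 2 *\<^sub>R y1" using y1y1f br_skew[of h' y1] by (simp add: h'_def)
  define p where "p = e - y1"
  have ffp: "br f (br f p) = 0" by (simp add: p_def br_simps ffe ffy1)
  define v where "v = br f p"
  have v_eq: "v = h' - h"
    using br_skew[of f y1] fe by (simp add: v_def p_def h'_def br_simps)
  have fv: "br f v = 0" using ffp by (simp add: v_def)

  have num: "2 *\<^sub>R w = w + w" "3 *\<^sub>R w = w + w + w" "6 *\<^sub>R w = w + w + w + w + w + w" for w :: 'v
    using scaleR_left_distrib[of 2 1 w] scaleR_left_distrib[of 3 3 w] by (simp_all add: scaleR_2)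
  have f3: "br f (br f (br f w)) = 0" for w
  proof -
    obtain c where "br f (br f w) = scl c f" using f by (auto simp: extremal_def)
    then show ?thesis by (simp add: S.br_scale_right)
  qed
  have he: "br h (br e w) = br e (br h w) + 2 *\<^sub>R br e w" for w
    using br_leibniz[of h e w] ef(2) by (simp add: br_simps)
  have hf: "br h (br f w) = br f (br h w) - 2 *\<^sub>R br f w" for w
    using br_leibniz[of h f w] ef(3) by (simp add: br_simps)
  have ef': "br e (br f w) = br f (br e w) + br h w" for w
    using br_leibniz[of e f w] ef(1) by simp
  \<comment> \<open>Obtained by commuting ad e past the third power of ad f, which is 0. The next
    identity commutes ad e past the square in the same way; it is applied to
    \<open>br h p\<close>.\<close>
  have ffh: "br f (br f (br h w)) = 2 *\<^sub>R br f (br f w)" for w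
  proof -
    have "br e (br f (br f (br f w))) =
        br f (br f (br f (br e w))) + 3 *\<^sub>R (br f (br f (br h w))) - 6 *\<^sub>R br f (br f w)"
      by (simp add: ef' hf br_simps num)
    then have "3 *\<^sub>R (br f (br f (br h w)) - 2 *\<^sub>R br f (br f w)) = 0" by (simp add: f3 br_simps algebra_simps)
    then show ?thesis by simp
  qed
  have ffe_p: "br f (br f (br e q)) + 2 *\<^sub>R br f (br h q) - 2 *\<^sub>R br f q = 0"
    if "br f (br f q) = 0" for q
  proof -
    have "br e (br f (br f q)) = br f (br f (br e q)) + 2 *\<^sub>R br f (br h q) - 2 *\<^sub>R br f q"
      by (simp add: ef' hf br_simps num)
    then show ?thesis using that by (simp add: br_simps)
  qed
  have "br f (br f (br h p)) = 0" by (simp add: ffh ffp)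
  then have "br f (br f (br e (br h p))) + 2 *\<^sub>R br f (br h (br h p)) - 2 *\<^sub>R br f (br h p) = 0"
    by (rule ffe_p)
  moreover have "br f (br f (br e (br h p))) = 0"
  proof -
    have "br e (br h p) = br h (br e p) - 2 *\<^sub>R br e p" by (simp add: he)
    then show ?thesis by (simp add: br_simps ffh)
  qed
  ultimately have "2 *\<^sub>R (br f (br h (br h p)) - br f (br h p)) = 0" by (simp add: algebra_simps)
  then have fhhp: "br f (br h (br h p)) = br f (br h p)" by simp
  \<comment> \<open>This is (ad h + 1)(ad h + 2) v = 0. In sl2 terms \<open>v\<close> is a sum of
    lowest weight vectors in the range of ad f, which excludes weight 0, and the vanishing cube of
    ad f excludes weights below -2.\<close>
  have hhv: "br h (br h v) = - 3 *\<^sub>R br h v - 2 *\<^sub>R v"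
    unfolding v_def hf br_simps fhhp by (simp add: num)

  \<comment> \<open>The spectral projections of \<open>v\<close> to the eigenvalues -1 and -2, read
    off from the quadratic relation.\<close>
  define v1 where "v1 = br h v + 2 *\<^sub>R v"
  define v2 where "v2 = - (br h v + v)"
  have v12: "v1 + v2 = v" by (simp add: v1_def v2_def scaleR_2)
  have hv1: "br h v1 = - v1"
    by (simp add: v1_def br_simps hhv num)
  have hv2: "br h v2 = - 2 *\<^sub>R v2"
    by (simp add: v2_def br_simps hhv num)
  have "br f (br h v) = 0" using hf[of v] fv by (simp add: br_simps)
  then have fv12: "br f v1 = 0" "br f v2 = 0" by (simp_all add: v1_def v2_def br_simps fv)
  obtain c2 where c2: "v2 = scl c2 f" using weight_minus2[OF hv2] by blast
  have v1v2: "br v1 v2 = 0"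
    using fv12(1) br_skew[of v1 f] by (simp add: c2 S.br_scale_right)
  \<comment> \<open>Each component is divided by minus its eigenvalue, so that
    \<open>br u h = v\<close>. As \<open>v2\<close> is a multiple of \<open>f\<close>,
    \<open>u\<close> commutes with \<open>v\<close> and the exponential series on \<open>h\<close>
    stops after two terms.\<close>
  define u where "u = v1 + (1 / 2) *\<^sub>R v2"
  have uh: "br u h = v"
    using hv1 hv2 br_skew[of u h] by (simp add: u_def br_simps add.commute flip: v12)
  have uf: "br u f = 0" using br_skew[of u f] fv12 by (simp add: u_def br_simps)
  have uv: "br u v = 0"
    using v1v2 br_skew[of v2 v1] by (simp add: u_def br_simps flip: v12)
  have "exp_ad br u h = h + br u h" by (rule exp_ad_two_terms) (simp add: uh uv)
  then have exp_h: "exp_ad br u h = h'" by (simp add: uh v_eq)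
  define z where "z = exp_ad br (- u) y1"
  have "br (exp_ad br (- u) h') z = 2 *\<^sub>R z"
    unfolding z_def exp_ad_br[symmetric] h'y1 by (rule linear_cmul[OF exp_ad_linear])
  then have "br h z = 2 *\<^sub>R z" by (simp add: exp_ad_minus flip: exp_h)
  then obtain c where c: "z = scl c e" using weight2 by blast
  have "y1 = exp_ad br u z" using exp_ad_minus[of "- u" y1] by (simp add: z_def)
  then have "y1 = scl c (exp_ad br u e)" by (simp add: c group_scl[OF exp_ad_in_group])
  then have "scl (- \<beta> / 2) y1 = scl (- \<beta> / 2 * c) (exp_ad br u e)" by simp
  moreover have "scl (- \<beta> / 2) y1 = y" using \<beta>0 by (simp add: y1_def)
  ultimately show ?thesis using that exp_ad_in_group by metis
qed

text \<open>The previous lemma asks that \<open>y\<close> pair nontrivially with \<open>f\<close>.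
  Simplicity supplies a group element and a scalar achieving this; the scalars are absorbed because
  nilpotent orbits are stable under them.\<close>

lemma extremal_conjugate:
  assumes e: "extremal e" "e \<noteq> 0" "br (mu e) e = N *\<^sub>R e" "N > 0"
    and y: "extremal y" "y \<noteq> 0"
  shows "y \<in> adjoint_orbit br e"
proof -
  \<comment> \<open>The factor comes from \<open>br e (\<theta> e) = - mu e\<close> and
    \<open>br (mu e) e = N *\<^sub>R e\<close>: it makes e, h, f a standard triple.\<close>
  define f where "f = (- 2 / N) *\<^sub>R \<theta> e"
  define h where "h = (2 / N) *\<^sub>R mu e"
  have \<theta>e: "br (mu e) (\<theta> e) = - N *\<^sub>R \<theta> e" by (rule \<theta>_eigenvector[OF \<theta>_mu e(3)])
  have ef: "br e f = h" "br h e = 2 *\<^sub>R e" "br h f = - 2 *\<^sub>R f"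
    using e(3,4) \<theta>e by (simp_all add: f_def h_def mu_def[symmetric] br_simps) (simp add: mu_def)
  have f_scl: "f = scl (of_real (- 2 / N)) (\<theta> e)" by (simp only: f_def scl_of_real)
  have f: "extremal f" unfolding f_scl by (intro extremal_scl extremal_\<theta> e)
  \<comment> \<open>Subtract the multiple of \<open>e\<close> with the same image under the square
    of ad (\<theta> e); the remainder falls under \<open>weight_vector_eq_0\<close>.\<close>
  have line: "\<exists>c. z = scl c e" if z: "br (mu e) z = N *\<^sub>R z" for z
  proof -
    obtain c where c: "br (\<theta> e) (br (\<theta> e) z) = scl c (\<theta> e)"
      using extremal_\<theta>[OF e(1)] by (auto simp: extremal_def)
    have "br (\<theta> e) e = mu e" using br_skew[of "\<theta> e" e] by (simp add: mu_def)
    then have \<theta>\<theta>e: "br (\<theta> e) (br (\<theta> e) e) = N *\<^sub>R \<theta> e"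
      using \<theta>e br_skew[of "\<theta> e" "mu e"] by simp
    define w where "w = z - scl (c / of_real N) e"
    have "br (\<theta> e) (br (\<theta> e) w) = scl c (\<theta> e) - scl (c / of_real N) (N *\<^sub>R \<theta> e)"
      by (simp add: w_def br_simps S.br_scale_right c \<theta>\<theta>e)
    also have "\<dots> = 0" using e(4) by (simp flip: scl_of_real)
    finally have "br (\<theta> e) (br (\<theta> e) w) = 0" .
    moreover have "br (mu e) w = N *\<^sub>R w"
      by (simp add: w_def br_simps S.br_scale_right z e(3) scl_scaleR algebra_simps)
    ultimately have "w = 0" using weight_vector_eq_0[OF e(3,4)] by blast
    then show ?thesis by (auto simp: w_def)
  qed
  have weight2: "\<exists>c. z = scl c e" if "br h z = 2 *\<^sub>R z" for z
  proof (rule line)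
    have "(N / 2) *\<^sub>R br h z = (N / 2) *\<^sub>R 2 *\<^sub>R z" using that by simp
    then show "br (mu e) z = N *\<^sub>R z" using e(4) by (simp add: h_def br_simps)
  qed
  have weight_minus2: "\<exists>c. z = scl c f" if "br h z = - 2 *\<^sub>R z" for z
  proof -
    have "\<theta> h = - h" by (simp add: h_def \<theta>_simps \<theta>_mu)
    from \<theta>_eigenvector[OF this that] obtain c where "\<theta> z = scl c e" using weight2 by auto
    then have "\<theta> (\<theta> z) = scl (cnj c) (\<theta> e)" by (simp add: \<theta>_scl)
    also have "\<theta> e = scl (of_real (- N / 2)) f" using e(4) by (simp add: f_scl flip: of_real_mult)
    finally show ?thesis unfolding \<theta>_\<theta> S.scale_scale by (rule exI)
  qed
  have "f \<noteq> 0" using e by (simp add: f_def)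
  have "linear (\<lambda>w. killing br w f)" by (rule linearI) (simp_all add: killing_simps)
  moreover have "killing br (\<theta> f) f \<noteq> 0"
    using B_pos[OF \<open>f \<noteq> 0\<close>] by (simp add: B_def killing_sym[of "\<theta> f"])
  ultimately obtain g a where g: "g \<in> adjoint_group br" "a \<noteq> 0" "killing br (scl a (g y)) f \<noteq> 0"
    using functional_on_orbit[of "\<lambda>w. killing br w f" "\<theta> f" y] y(2) by auto
  have "extremal (scl a (g y))" by (rule extremal_scl[OF extremal_group[OF g(1) y(1)]])
  from extremal_conjugate_aux[OF ef f weight2 weight_minus2 this g(3)]
  obtain k b where k: "k \<in> adjoint_group br" "scl a (g y) = scl b (k e)" by metis
  have "b \<noteq> 0" using k(2) g(3) by (auto simp: killing_simps)
  have "g y = scl (1 / a) (scl a (g y))" using g(2) by simp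
  also have "\<dots> = k (scl (b / a) e)" by (simp add: k(2) group_scl[OF k(1)])
  also have "\<dots> \<in> adjoint_orbit br e"
    using \<open>b \<noteq> 0\<close> g(2)
    by (intro orbit_group[OF k(1)] orbit_scl[OF extremal_nilpotent[OF e(1)]]) simp
  finally have "g y \<in> adjoint_orbit br e" .
  moreover obtain g' where "g' \<in> adjoint_group br" "g' (g y) = y"
    using adjoint_group_inverse[OF g(1)] by metis
  ultimately show ?thesis using orbit_group by metis
qed

lemma invariant_cone_closure_orbit:
  assumes "ad_nilpotent br x"
  shows "invariant_cone (closure (adjoint_orbit br x))"
  unfolding invariant_cone_def
proof (intro conjI ballI allI impI)
  show "g ` closure (adjoint_orbit br x) \<subseteq> closure (adjoint_orbit br x)" if "g \<in> adjoint_group br" for g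
    using closure_orbit_group[OF that] by blast
  show "scl c ` closure (adjoint_orbit br x) \<subseteq> closure (adjoint_orbit br x)" if c: "c \<noteq> 0" for c
  proof (rule image_closure_subset)
    show "continuous_on (closure (adjoint_orbit br x)) (scl c)"
      by (intro linear_continuous_on linear_conv_bounded_linear[THEN iffD1] scl_linear)
    have "scl c y \<in> adjoint_orbit br x" if y: "y \<in> adjoint_orbit br x" for y
    proof -
      obtain g where g: "g \<in> adjoint_group br" "y = g x" using y by (auto simp: adjoint_orbit_def)
      then have "scl c y = g (scl c x)" by (simp add: group_scl)
      then show ?thesis using orbit_group[OF g(1) orbit_scl[OF assms c]] by simp
    qed
    then show "scl c ` adjoint_orbit br x \<subseteq> closure (adjoint_orbit br x)"
      using closure_subset by blast
  qed simp
qed simp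

lemma group_eq_0:
  assumes "g \<in> adjoint_group br" "g x = 0"
  shows "x = 0"
proof -
  obtain h where "h \<in> adjoint_group br" "h (g x) = x" using adjoint_group_inverse[OF assms(1)] by metis
  then show ?thesis using assms(2) linear_0[OF adjoint_group_linear] by metis
qed

theorem O_min_eq: "O_min br = {x. x \<noteq> 0 \<and> extremal x}"
proof -
  let ?E = "{x. x \<noteq> 0 \<and> extremal x}"
  obtain x x' where "br x x' \<noteq> 0" using S.nonabelian by blast
  then have "x \<noteq> 0" by (auto simp: br_simps)
  \<comment> \<open>The whole space is used as the cone to obtain a first extremal element.\<close>
  moreover have "invariant_cone UNIV" by (simp add: invariant_cone_def)
  ultimately obtain e N where e: "e \<noteq> 0" "extremal e" "N > 0" "br (mu e) e = N *\<^sub>R e"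
    using invariant_cone_contains_extremal by (metis UNIV_I)
  have orbit: "adjoint_orbit br y = ?E" if "y \<in> ?E" for y
  proof -
    have "adjoint_orbit br y = adjoint_orbit br e"
      using extremal_conjugate[OF e(2,1,4,3)] that by (intro orbit_eq) blast
    also have "\<dots> = ?E"
      using extremal_conjugate[OF e(2,1,4,3)] extremal_group[OF _ e(2)] group_eq_0[of _ e] e(1)
      by (auto simp: adjoint_orbit_def)
    finally show ?thesis .
  qed
  have nil: "\<exists>x. \<Omega> = adjoint_orbit br x \<and> x \<noteq> 0 \<and> ad_nilpotent br x"
    if "\<Omega> \<in> nonzero_nilpotent_orbits br" for \<Omega>
    using that by (auto simp: nonzero_nilpotent_orbits_def)
  have E_orbit: "?E \<in> nonzero_nilpotent_orbits br"
    using orbit[of e] e extremal_nilpotent unfolding nonzero_nilpotent_orbits_def by blast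
  have E_minimal: "\<Omega> = ?E" if \<Omega>: "\<Omega> \<in> nonzero_nilpotent_orbits br" "\<Omega> \<subseteq> closure ?E" for \<Omega>
  proof -
    obtain x where x: "\<Omega> = adjoint_orbit br x" "x \<noteq> 0" using nil[OF \<Omega>(1)] by blast
    then have "x \<in> closure ?E" using \<Omega>(2) orbit_self by blast
    then have "x \<in> closure {x. extremal x}"
      using closure_mono[of ?E "{x. extremal x}"] by blast
    then show ?thesis using orbit[of x] extremal_closure x by blast
  qed
  \<comment> \<open>Being least, and not merely minimal, gives the uniqueness behind
    \<open>THE\<close>.\<close>
  have E_least: "?E \<subseteq> closure \<Omega>" if \<Omega>: "\<Omega> \<in> nonzero_nilpotent_orbits br" for \<Omega>
  proof -
    obtain x where x: "\<Omega> = adjoint_orbit br x" "x \<noteq> 0" "ad_nilpotent br x"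
      using nil[OF \<Omega>] by blast
    have "x \<in> closure \<Omega>" using orbit_self closure_subset x(1) by blast
    then obtain w where w: "w \<in> closure \<Omega>" "w \<in> ?E"
      using invariant_cone_contains_extremal[OF invariant_cone_closure_orbit[OF x(3)]] x by blast
    then have "adjoint_orbit br w \<subseteq> closure \<Omega>"
      unfolding x(1) using closure_orbit_group by (auto simp: adjoint_orbit_def[of br w])
    then show ?thesis using orbit[OF w(2)] by simp
  qed
  show ?thesis
    unfolding O_min_def
  proof (rule the_equality)
    show "minimal_nilpotent_orbit br ?E"
      using E_orbit E_minimal by (auto simp: minimal_nilpotent_orbit_def)
    show "\<Omega> = ?E" if "minimal_nilpotent_orbit br \<Omega>" for \<Omega>
      using that E_orbit E_least[of \<Omega>] unfolding minimal_nilpotent_orbit_def by blast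
  qed
qed

end

section \<open>Complexification and restricted roots\<close>

lemma cscale_of_real: "cscale (of_real r) z = r *\<^sub>R z"
  by (simp add: cscale_def prod_eq_iff)

lemma norm_cscale: "norm (cscale c z) = cmod c * norm z"
  for z :: "'g::real_inner \<times> 'g"
proof -
  have "(norm (cscale c z))\<^sup>2 = (cmod c * norm z)\<^sup>2"
    unfolding power_mult_distrib power2_norm_eq_inner cmod_power2
    by (simp add: cscale_def inner_prod_def inner_diff_left inner_diff_right inner_add_left
        inner_add_right inner_commute power2_eq_square inner_complex_def algebra_simps)
  then show ?thesis by simp
qed

text \<open>The conjugate linear extension; with the complex linear one the form would be negative
  on the imaginary part.\<close>

definition conj_extension :: "('g::real_vector \<Rightarrow> 'g) \<Rightarrow> 'g \<times> 'g \<Rightarrow> 'g \<times> 'g" where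
  "conj_extension \<theta> z = (\<theta> (fst z), - \<theta> (snd z))"

lemma sum_Basis_prod:
  fixes f :: "'a::euclidean_space \<times> 'b::euclidean_space \<Rightarrow> 'c::comm_monoid_add"
  shows "sum f Basis = (\<Sum>b\<in>Basis. f (b, 0)) + (\<Sum>b\<in>Basis. f (0, b))"
  unfolding Basis_prod_def
  by (subst sum.union_disjoint) (auto simp: sum.reindex inj_on_def)

context cartan_lie_algebra
begin

text \<open>Twice the real part of the complex Killing form, since the trace is taken over the
  reals.\<close>

lemma killing_complexify:
  "killing (complexify br) z w = 2 * (killing br (fst z) (fst w) - killing br (snd z) (snd w))"
  by (simp add: killing_def lin_trace_def sum_Basis_prod complexify_def inner_diff_left
      br_simps sum_subtractf)

lemma cartan_complexify: "cartan_lie_algebra (complexify br) (conj_extension \<theta>)"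
proof (intro cartan_lie_algebra.intro real_lie_algebra.intro cartan_lie_algebra_axioms.intro)
  interpret C: lie_algebra cscale "complexify br"
    by (rule lie_algebra_complexify[OF lie])
  show "lie_algebra (*\<^sub>R) (complexify br)"
    by unfold_locales (auto simp: C.br_add_left C.br_add_right C.br_self C.jacobi
        C.br_scale_left C.br_scale_right scaleR_add_right scaleR_add_left simp flip: cscale_of_real)
  have "linear (conj_extension \<theta>)"
    by (rule linearI) (simp_all add: conj_extension_def \<theta>_simps)
  moreover have "killing (complexify br) z (conj_extension \<theta> z) < 0" if "z \<noteq> 0" for z
  proof -
    have "killing (complexify br) z (conj_extension \<theta> z) = - 2 * (B (fst z) (fst z) + B (snd z) (snd z))"
      by (simp add: killing_complexify conj_extension_def killing_simps B_def)
    moreover have "B (fst z) (fst z) + B (snd z) (snd z) > 0"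
      using that B_pos[of "fst z"] B_pos[of "snd z"] B_nonneg[of "fst z"] B_nonneg[of "snd z"]
      by (cases "fst z = 0") (auto simp: prod_eq_iff intro: add_pos_nonneg)
    ultimately show ?thesis by simp
  qed
  ultimately show "cartan_involution (complexify br) (conj_extension \<theta>)"
    by (auto simp: cartan_involution_def conj_extension_def complexify_def \<theta>_simps br_simps
        prod_eq_iff)
qed

text \<open>The square of ad (e, 0) acts on real and imaginary parts separately, so one complex
  scalar amounts to two independent real ones.\<close>

lemma O_min_complexify:
  assumes "simple_lie_algebra cscale (complexify br)"
  shows "(e, 0) \<in> O_min (complexify br) \<longleftrightarrow> e \<noteq> 0 \<and> (\<forall>y. \<exists>r. br e (br e y) = r *\<^sub>R e)"
proof -
  interpret C: complex_cartan_algebra "complexify br" "conj_extension \<theta>" cscale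
    by (intro complex_cartan_algebra.intro cartan_complexify complex_cartan_algebra_axioms.intro assms)
      (auto simp: cscale_of_real norm_cscale, simp add: conj_extension_def cscale_def \<theta>_simps prod_eq_iff)
  have ee: "complexify br (e, 0) (complexify br (e, 0) w) = (br e (br e (fst w)), br e (br e (snd w)))" for w
    by (simp add: complexify_def br_simps)
  have scl: "cscale c (e, 0) = (Re c *\<^sub>R e, Im c *\<^sub>R e)" for c
    by (simp add: cscale_def)
  have "C.extremal (e, 0) \<longleftrightarrow> (\<forall>y. \<exists>r. br e (br e y) = r *\<^sub>R e)"
  proof
    assume "C.extremal (e, 0)"
    then have "\<exists>c. br e (br e y) = Re c *\<^sub>R e" for y
      unfolding C.extremal_def ee scl by (metis fst_conv)
    then show "\<forall>y. \<exists>r. br e (br e y) = r *\<^sub>R e" by blast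
  next
    assume "\<forall>y. \<exists>r. br e (br e y) = r *\<^sub>R e"
    then obtain r where "\<And>y. br e (br e y) = r y *\<^sub>R e" by metis
    then have "complexify br (e, 0) (complexify br (e, 0) w) = cscale (Complex (r (fst w)) (r (snd w))) (e, 0)" for w
      by (simp add: ee scl)
    then show "C.extremal (e, 0)" unfolding C.extremal_def by blast
  qed
  then show ?thesis by (simp add: C.O_min_eq prod_eq_iff)
qed

end

text \<open>A proper ideal of the complexification meets the real form trivially and projects onto it, so
  that it is the graph of a complex structure commuting with the adjoint action.\<close>

lemma simple_complexify:
  fixes br :: "'g::euclidean_space \<Rightarrow> 'g \<Rightarrow> 'g"
  assumes simple: "simple_lie_algebra (*\<^sub>R) br"
    and no_complex_structure: "\<And>J. linear J \<Longrightarrow> (\<And>x y. J (br x y) = br x (J y)) \<Longrightarrow> (\<And>x. J (J x) = - x) \<Longrightarrow> False"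
  shows "simple_lie_algebra cscale (complexify br)"
proof -
  interpret R: simple_lie_algebra "(*\<^sub>R)" br by (rule simple)
  interpret L: real_lie_algebra br by unfold_locales
  interpret C: lie_algebra cscale "complexify br"
    by (rule lie_algebra_complexify) unfold_locales
  show ?thesis
  proof
    obtain x y where "br x y \<noteq> 0" using R.nonabelian by blast
    then have "complexify br (x, 0) (y, 0) \<noteq> 0" by (simp add: complexify_def prod_eq_iff)
    then show "\<exists>x y. complexify br x y \<noteq> 0" by blast
  next
    fix I assume "lie_ideal cscale (complexify br) I"
    then have I: "C.subspace I" "\<And>z w. w \<in> I \<Longrightarrow> complexify br z w \<in> I"
      by (auto simp: lie_ideal_def)
    have I_add: "z + w \<in> I" if "z \<in> I" "w \<in> I" for z w using C.subspace_add[OF I(1)] that .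
    have I_scale: "cscale c z \<in> I" if "z \<in> I" for c z using C.subspace_scale[OF I(1)] that .
    have I_0: "0 \<in> I" using C.subspace_0[OF I(1)] .
    have I_i: "(- y, x) \<in> I" if "(x, y) \<in> I" for x y
      using I_scale[OF that, of \<i>] by (simp add: cscale_def)
    have I_real: "(r *\<^sub>R x, r *\<^sub>R y) \<in> I" if "(x, y) \<in> I" for r x y
      using I_scale[OF that, of "of_real r"] by (simp add: cscale_of_real)
    have I_br: "(br z x, br z y) \<in> I" if "(x, y) \<in> I" for z x y
      using I(2)[OF that, of "(z, 0)"] by (simp add: complexify_def L.br_simps)
    have "lie_ideal (*\<^sub>R) br {x. (x, 0) \<in> I}"
      unfolding lie_ideal_def subspace_raw_def[symmetric] subspace_def
      using I_0 I_add[of "(_, 0)" "(_, 0)"] I_real[of _ 0] I_br[of _ 0]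
      by (auto simp: zero_prod_def L.br_simps)
    then have real_part: "{x. (x, 0) \<in> I} = {0} \<or> {x. (x, 0) \<in> I} = UNIV" by (rule R.ideals_trivial)
    have "lie_ideal (*\<^sub>R) br (fst ` I)"
      unfolding lie_ideal_def subspace_raw_def[symmetric] subspace_def
    proof (intro conjI ballI allI)
      show "0 \<in> fst ` I" using I_0 by force
      show "x + y \<in> fst ` I" if "x \<in> fst ` I" "y \<in> fst ` I" for x y
        using that I_add by (force simp: image_iff)
      show "c *\<^sub>R x \<in> fst ` I" if "x \<in> fst ` I" for c x
        using that I_real by (force simp: image_iff)
      show "br z x \<in> fst ` I" if "x \<in> fst ` I" for z x
        using that I_br by (force simp: image_iff)
    qed
    then have proj: "fst ` I = {0} \<or> fst ` I = UNIV" by (rule R.ideals_trivial)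
    consider "fst ` I = {0}" | "{x. (x, 0) \<in> I} = UNIV" | "fst ` I = UNIV" "{x. (x, 0) \<in> I} = {0}"
      using real_part proj by blast
    then show "I = {0} \<or> I = UNIV"
    proof cases
      case 1
      have "z = 0" if "z \<in> I" for z
      proof -
        have "(fst z, snd z) \<in> I" using that by simp
        from imageI[OF this, of fst] imageI[OF I_i[OF this], of fst]
        have "fst z \<in> fst ` I" "- snd z \<in> fst ` I" by simp_all
        then show ?thesis using 1 by (simp add: prod_eq_iff)
      qed
      then show ?thesis using I_0 by blast
    next
      case 2
      have "z \<in> I" for z
      proof -
        have "(fst z, 0) \<in> I" "(snd z, 0) \<in> I" using 2 by blast+
        then show ?thesis using I_add[of "(fst z, 0)" "(- 0, snd z)"] I_i[of "snd z" 0] by simp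
      qed
      then show ?thesis by blast
    next
      case 3
      then have "\<exists>y. (x, y) \<in> I" for x by (metis UNIV_I imageE prod.collapse)
      then obtain J where J: "\<And>x. (x, J x) \<in> I" by metis
      have unique: "y = J x" if "(x, y) \<in> I" for x y
      proof -
        have "(0, y - J x) \<in> I"
          using I_add[OF that I_real[OF J[of x], of "- 1"]] by simp
        then have "(- (y - J x), 0) \<in> I" using I_i by blast
        then have "- (y - J x) = 0" using 3 by blast
        then show ?thesis by simp
      qed
      have "J (br z x) = br z (J x)" for z x using unique[OF I_br[OF J]] by simp
      moreover have "J (J x) = - x" for x
      proof -
        have "(J x, - x) \<in> I" using I_real[OF I_i[OF J[of x]], of "- 1"] by simp
        then show ?thesis using unique by simp
      qed
      moreover have "linear J"
      proof (rule linearI)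
        show "J (x + y) = J x + J y" for x y
          by (rule unique[symmetric]) (use I_add[OF J[of x] J[of y]] in simp)
        show "J (r *\<^sub>R x) = r *\<^sub>R J x" for r x
          by (rule unique[symmetric]) (rule I_real[OF J])
      qed
      ultimately show ?thesis using no_complex_structure by blast
    qed
  qed
qed

section \<open>Restricted roots, the highest root space and the centre\<close>

locale restricted_root_system = cartan_lie_algebra br \<theta>
  for br :: "'v::euclidean_space \<Rightarrow> 'v \<Rightarrow> 'v" and \<theta> +
  fixes A :: "'v set" and P :: "('v \<Rightarrow> real) set" and \<psi> :: "'v \<Rightarrow> real" and h0 :: 'v
  assumes max_abelian: "maximal_abelian_in br (cartan_p \<theta>) A"
    and h0: "h0 \<in> A" "\<And>\<beta>. \<beta> \<in> restricted_roots br A \<Longrightarrow> \<beta> h0 \<noteq> 0"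
    and P: "P = {\<beta> \<in> restricted_roots br A. \<beta> h0 > 0}"
    and highest: "highest_root br A P \<psi>"
begin

lemma A_p: "h \<in> A \<Longrightarrow> \<theta> h = - h" and A_comm: "h \<in> A \<Longrightarrow> k \<in> A \<Longrightarrow> br h k = 0"
  and A_subspace: "subspace A"
  using max_abelian by (auto simp: maximal_abelian_in_def abelian_subspace_def cartan_p_def)

lemma in_A_if_centralizes:
  assumes z: "\<theta> z = - z" "\<And>h. h \<in> A \<Longrightarrow> br h z = 0"
  shows "z \<in> A"
proof -
  have decomp: "\<exists>a\<in>A. \<exists>k. x = a + k *\<^sub>R z" if x: "x \<in> span (insert z A)" for x
  proof -
    obtain k where "x - k *\<^sub>R z \<in> span A" using x unfolding span_breakdown_eq by blast
    then have "x - k *\<^sub>R z \<in> A" using A_subspace by (simp add: span_eq_iff[THEN iffD2])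
    then show ?thesis by (intro bexI[of _ "x - k *\<^sub>R z"] exI[of _ k]) simp_all
  qed
  have "br x y = 0" if xy: "x \<in> span (insert z A)" "y \<in> span (insert z A)" for x y
  proof -
    obtain a k b l where "a \<in> A" "x = a + k *\<^sub>R z" "b \<in> A" "y = b + l *\<^sub>R z"
      using decomp xy by metis
    then show ?thesis using z(2)[of a] z(2)[of b] br_skew[of z b] A_comm[of a b] by (simp add: br_simps)
  qed
  moreover have "span (insert z A) \<subseteq> cartan_p \<theta>"
  proof
    fix x assume "x \<in> span (insert z A)"
    then obtain a k where "a \<in> A" "x = a + k *\<^sub>R z" using decomp by blast
    then show "x \<in> cartan_p \<theta>" using A_p[of a] z(1) by (simp add: cartan_p_def \<theta>_simps)
  qed
  moreover have "A \<subseteq> span (insert z A)" using span_superset by blast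
  ultimately have "span (insert z A) = A"
    using max_abelian by (auto simp: maximal_abelian_in_def abelian_subspace_def)
  then show ?thesis using span_base[of z "insert z A"] by simp
qed

lemma root_spaceD: "x \<in> root_space br A \<beta> \<Longrightarrow> h \<in> A \<Longrightarrow> br h x = \<beta> h *\<^sub>R x"
  by (simp add: root_space_def)

lemma root_space_subspace: "subspace (root_space br A \<beta>)"
  by (auto simp: subspace_def root_space_def br_simps scaleR_add_right)

lemma root_vector:
  assumes "\<beta> \<in> restricted_roots br A"
  obtains x where "x \<in> root_space br A \<beta>" "x \<noteq> 0"
  using assms subspace_0[OF root_space_subspace] by (auto simp: restricted_roots_def)

lemma root_eqI:
  assumes "\<beta> \<in> restricted_roots br A" "\<gamma> \<in> restricted_roots br A" "\<And>h. h \<in> A \<Longrightarrow> \<beta> h = \<gamma> h"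
  shows "\<beta> = \<gamma>"
proof
  show "\<beta> h = \<gamma> h" for h
    using assms by (cases "h \<in> A") (simp_all add: restricted_roots_def dual_of_def)
qed

lemma weight_cases:
  assumes "x \<noteq> 0" "\<And>h. h \<in> A \<Longrightarrow> br h x = w h *\<^sub>R x"
  shows "(\<forall>h\<in>A. w h = 0) \<or> (\<exists>\<beta>\<in>restricted_roots br A. \<forall>h\<in>A. \<beta> h = w h)"
proof (cases "\<forall>h\<in>A. w h = 0")
  case False
  \<comment> \<open>\<open>w\<close> is arbitrary off \<open>A\<close>, whereas
    \<open>dual_of\<close> wants 0 there; additivity and homogeneity on \<open>A\<close> follow from
    those of the bracket because \<open>x\<close> is nonzero.\<close>
  define \<beta> where "\<beta> h = (if h \<in> A then w h else 0)" for h
  have "w (h + k) *\<^sub>R x = (w h + w k) *\<^sub>R x" if "h \<in> A" "k \<in> A" for h k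
    using assms(2)[of "h + k"] assms(2)[of h] assms(2)[of k] that A_subspace
    by (simp add: br_simps subspace_add scaleR_add_left del: scaleR_cancel_right)
  moreover have "w (r *\<^sub>R h) *\<^sub>R x = (r * w h) *\<^sub>R x" if "h \<in> A" for r h
    using assms(2)[of "r *\<^sub>R h"] assms(2)[of h] that A_subspace
    by (simp add: br_simps subspace_scale del: scaleR_cancel_right)
  ultimately have "\<beta> \<in> dual_of A"
    using assms(1) A_subspace by (auto simp: dual_of_def \<beta>_def subspace_add subspace_scale)
  moreover have "\<beta> \<noteq> (\<lambda>_. 0)" using False by (auto simp: \<beta>_def fun_eq_iff)
  moreover have "x \<in> root_space br A \<beta>" using assms(2) by (simp add: root_space_def \<beta>_def)
  ultimately have "\<beta> \<in> restricted_roots br A" using assms(1) by (auto simp: restricted_roots_def)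
  then show ?thesis by (intro disjI2 bexI[of _ \<beta>]) (simp_all add: \<beta>_def)
qed simp

lemma \<psi>_in_P: "\<psi> \<in> P" and \<psi>_root: "\<psi> \<in> restricted_roots br A" and \<psi>_h0: "\<psi> h0 > 0"
  using highest P by (auto simp: highest_root_def)

lemma highest_expansion:
  assumes "\<beta> \<in> restricted_roots br A"
  obtains c :: "('v \<Rightarrow> real) \<Rightarrow> nat" where "\<And>h. h \<in> A \<Longrightarrow> \<psi> h - \<beta> h = (\<Sum>\<gamma>\<in>P. real (c \<gamma>) * \<gamma> h)"
  using highest assms by (auto simp: highest_root_def)

lemma highest_ge:
  assumes "\<beta> \<in> restricted_roots br A" "t \<in> A" "\<And>\<gamma>. \<gamma> \<in> P \<Longrightarrow> \<gamma> t \<ge> 0"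
  shows "\<beta> t \<le> \<psi> t"
proof -
  obtain c where "\<psi> t - \<beta> t = (\<Sum>\<gamma>\<in>P. real (c \<gamma>) * \<gamma> t)"
    using highest_expansion[OF assms(1)] assms(2) by metis
  also have "\<dots> \<ge> 0" using assms(3) by (intro sum_nonneg mult_nonneg_nonneg) auto
  finally show ?thesis by simp
qed

lemma highest_unique:
  assumes "\<beta> \<in> restricted_roots br A" "\<beta> h0 = \<psi> h0" "h \<in> A"
  shows "\<beta> h = \<psi> h"
proof -
  obtain c where c: "\<And>h. h \<in> A \<Longrightarrow> \<psi> h - \<beta> h = (\<Sum>\<gamma>\<in>P. real (c \<gamma>) * \<gamma> h)"
    using highest_expansion[OF assms(1)] by metis
  have "(\<Sum>\<gamma>\<in>P. real (c \<gamma>) * \<gamma> h) = 0"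
  \<comment> \<open>Over an infinite set the sum is 0 by convention, as claimed; in the finite case
    every term is nonnegative at \<open>h0\<close>.\<close>
  proof (cases "finite P")
    case True
    have "(\<Sum>\<gamma>\<in>P. real (c \<gamma>) * \<gamma> h0) = 0" using c[OF h0(1)] assms(2) by simp
    then have "real (c \<gamma>) * \<gamma> h0 = 0" if "\<gamma> \<in> P" for \<gamma>
      using that True by (subst (asm) sum_nonneg_eq_0_iff) (auto simp: P)
    then have "c \<gamma> = 0" if "\<gamma> \<in> P" for \<gamma> using that by (fastforce simp: P)
    then show ?thesis by simp
  qed simp
  then show ?thesis using c[OF assms(3)] by simp
qed

lemma weight_le:
  assumes "x \<noteq> 0" "\<And>h. h \<in> A \<Longrightarrow> br h x = w h *\<^sub>R x"
  shows "w h0 \<le> \<psi> h0" and "w h0 = \<psi> h0 \<Longrightarrow> h \<in> A \<Longrightarrow> w h = \<psi> h"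
  using weight_cases[OF assms] highest_ge[OF _ h0(1)] highest_unique[of _ h] h0(1) \<psi>_h0 P by force+

lemma weight_ge:
  assumes "x \<noteq> 0" "\<And>h. h \<in> A \<Longrightarrow> br h x = w h *\<^sub>R x"
  shows "- \<psi> h0 \<le> w h0"
  using weight_le(1)[of "\<theta> x" "\<lambda>h. - w h"] \<theta>_eigenvector[OF A_p assms(2)] assms(1) by simp

lemma span_weight_vectors: "y \<in> span {x. \<forall>h\<in>A. \<exists>\<mu>. br h x = \<mu> *\<^sub>R x}"
proof -
  have comm: "br h (br k x) = br k (br h x)" if "h \<in> A" "k \<in> A" for h k x
    using br_leibniz[of h k x] A_comm[OF that] by (simp add: br_simps)
  have "selfadjoint_family (br ` A)"
    unfolding selfadjoint_family_def using br_linear B_br_p[OF A_p] comm by auto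
  from span_joint_eigenvectors[OF this subspace_UNIV]
  have "UNIV \<subseteq> span {x. \<forall>T\<in>br ` A. \<exists>\<mu>. T x = \<mu> *\<^sub>R x}" by simp
  moreover have "{x. \<forall>T\<in>br ` A. \<exists>\<mu>. T x = \<mu> *\<^sub>R x} = {x. \<forall>h\<in>A. \<exists>\<mu>. br h x = \<mu> *\<^sub>R x}" by auto
  ultimately show ?thesis by auto
qed

text \<open>At \<open>h0\<close> all weights lie between \<open>- \<psi> h0\<close> and
  \<open>\<psi> h0\<close>. Two raisings by \<open>\<psi> h0\<close> therefore give 0 or the top
  value, and by \<open>weight_le\<close> the top value at \<open>h0\<close> already identifies the
  weight as \<psi>.\<close>

lemma ad_square_highest:
  assumes e: "e \<in> root_space br A \<psi>"
  shows "br e (br e y) \<in> root_space br A \<psi>"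
  using span_weight_vectors[of y]
proof (induction rule: span_induct)
  case base
  show ?case
    using root_space_subspace[of \<psi>] by (auto simp: subspace_def br_simps)
next
  case (step v)
  then have "\<forall>h\<in>A. \<exists>\<mu>. br h v = \<mu> *\<^sub>R v" by simp
  then obtain w where w: "\<And>h. h \<in> A \<Longrightarrow> br h v = w h *\<^sub>R v" 
    using bchoice[of A "\<lambda>h \<mu>. br h v = \<mu> *\<^sub>R v"] by blast
  let ?u = "br e (br e v)"
  have u: "br h ?u = (\<psi> h + (\<psi> h + w h)) *\<^sub>R ?u" if "h \<in> A" for h
    by (intro br_eigenvectors root_spaceD[OF e that] w[OF that])
  show ?case
  proof (cases "?u = 0")
    case True
    then show ?thesis using subspace_0[OF root_space_subspace] by simp
  next
    case False
    then have "v \<noteq> 0" by (auto simp: br_simps)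
    have "\<psi> h0 + (\<psi> h0 + w h0) = \<psi> h0"
      using weight_le(1)[OF False u] weight_ge[OF \<open>v \<noteq> 0\<close> w] by simp
    then have "\<psi> h + (\<psi> h + w h) = \<psi> h" if "h \<in> A" for h
      using weight_le(2)[OF False u _ that] by blast
    then show ?thesis using u by (simp add: root_space_def)
  qed
qed

lemma mu_in_A:
  assumes "x \<in> root_space br A \<beta>"
  shows "mu x \<in> A"
proof (rule in_A_if_centralizes[OF \<theta>_mu])
  fix h assume h: "h \<in> A"
  have "br h (br x (\<theta> x)) = (\<beta> h + - \<beta> h) *\<^sub>R br x (\<theta> x)"
    using root_spaceD[OF assms h] by (intro br_eigenvectors \<theta>_eigenvector A_p[OF h])
  then show "br h (mu x) = 0" by (simp add: mu_def br_simps)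
qed

text \<open>On \<open>A\<close> one has \<open>B h (mu x) = \<beta> h * B x x\<close>: up to a
  positive factor \<open>mu x\<close> is the vector representing \<beta>, and the claim is
  positivity of its length.\<close>

lemma root_mu_pos:
  assumes x: "x \<in> root_space br A \<beta>" "x \<noteq> 0" and "\<beta> h0 \<noteq> 0"
  shows "\<beta> (mu x) > 0"
proof -
  have "B h0 (mu x) = \<beta> h0 * B x x"
    using B_mu[of h0 x] root_spaceD[OF x(1) h0(1)] by (simp add: B_simps)
  then have "mu x \<noteq> 0" using assms(3) x(2) by (auto simp: B_simps)
  have "B (mu x) (mu x) = \<beta> (mu x) * B x x"
    by (intro mu_eigenvalue root_spaceD[OF x(1)] mu_in_A[OF x(1)])
  then show ?thesis
    using B_pos[OF \<open>mu x \<noteq> 0\<close>] B_pos[OF x(2)] by (simp add: zero_less_mult_iff)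
qed

text \<open>A root vector centralizing \<open>\<nn>\<close> belongs to a dominant root \<open>\<beta>\<close>. Since \<open>\<psi> - \<beta>\<close> is a sum of
  positive roots, \<open>\<psi>\<close> and \<open>\<beta>\<close> have positive inner product, which forces \<open>\<psi> - \<beta>\<close> to be a positive root
  unless it vanishes.\<close>

lemma central_root_vector:
  assumes \<beta>: "\<beta> \<in> P" and x: "x \<in> root_space br A \<beta>" "x \<noteq> 0"
    and central: "\<And>\<gamma> y. \<gamma> \<in> P \<Longrightarrow> y \<in> root_space br A \<gamma> \<Longrightarrow> br x y = 0"
  shows "\<beta> = \<psi>"
proof (rule ccontr)
  assume "\<beta> \<noteq> \<psi>"
  define t where "t = mu x"
  have t: "t \<in> A" unfolding t_def by (rule mu_in_A[OF x(1)])
  have \<beta>_root: "\<beta> \<in> restricted_roots br A" "\<beta> h0 > 0" using \<beta> P by auto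
  have x\<theta>x: "br x (br (\<theta> x) y) = - br t y" if "br x y = 0" for y
    using br_leibniz[of x "\<theta> x" y] that by (simp add: t_def mu_def br_simps)
  \<comment> \<open>As \<open>x\<close> kills \<open>y\<close>, the squared length of
    \<open>br (\<theta> x) y\<close> is \<open>\<gamma> t * B y y\<close>.\<close>
  have dominant: "\<gamma> t \<ge> 0" if \<gamma>: "\<gamma> \<in> P" for \<gamma>
  proof -
    obtain y where y: "y \<in> root_space br A \<gamma>" "y \<noteq> 0" using root_vector \<gamma> P by blast
    have "B (br (\<theta> x) y) (br (\<theta> x) y) = \<gamma> t * B y y"
      using x\<theta>x[OF central[OF \<gamma> y(1)]] root_spaceD[OF y(1) t] by (simp add: B_br B_simps)
    then show ?thesis using B_nonneg[of "br (\<theta> x) y"] B_pos[OF y(2)] by (simp add: zero_le_mult_iff)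
  qed
  have "\<beta> t > 0" unfolding t_def using root_mu_pos[OF x] \<beta>_root(2) by simp
  also have "\<beta> t \<le> \<psi> t" using highest_ge[of \<beta> t] \<beta>_root(1) t dominant by blast
  finally have "\<psi> t > 0" .
  obtain z where z: "z \<in> root_space br A \<psi>" "z \<noteq> 0" using root_vector[OF \<psi>_root] by blast
  define u where "u = br (\<theta> x) z"
  have u: "br h u = (\<psi> h - \<beta> h) *\<^sub>R u" if "h \<in> A" for h
    using br_eigenvectors[OF \<theta>_eigenvector[OF A_p[OF that] root_spaceD[OF x(1) that]] root_spaceD[OF z(1) that]]
    by (simp add: u_def)
  \<comment> \<open>A nonzero \<open>u\<close> has weight \<psi> - \<beta>, which is not 0 and hence
    a root; it is positive because \<psi> dominates \<beta> at \<open>h0\<close>, so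
    \<open>x\<close> kills its root space. The value computed next is nonzero.\<close>
  have "br x u = 0"
  proof (cases "u = 0")
    case False
    from weight_cases[OF False u] show ?thesis
    proof
      assume "\<forall>h\<in>A. \<psi> h - \<beta> h = 0"
      then show ?thesis using root_eqI[OF \<beta>_root(1) \<psi>_root] \<open>\<beta> \<noteq> \<psi>\<close> by simp
    next
      assume "\<exists>\<delta>\<in>restricted_roots br A. \<forall>h\<in>A. \<delta> h = \<psi> h - \<beta> h"
      then obtain \<delta> where \<delta>: "\<delta> \<in> restricted_roots br A" "\<And>h. h \<in> A \<Longrightarrow> \<delta> h = \<psi> h - \<beta> h" by blast
      have "\<beta> h0 \<le> \<psi> h0" using highest_ge[OF \<beta>_root(1) h0(1)] P by force
      then have "\<delta> \<in> P" using \<delta> h0 P by force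
      moreover have "u \<in> root_space br A \<delta>" using u \<delta>(2) by (simp add: root_space_def)
      ultimately show ?thesis by (rule central)
    qed
  qed (simp add: br_simps)
  moreover have "br x u = - \<psi> t *\<^sub>R z"
    using x\<theta>x[OF central[OF \<psi>_in_P z(1)]] root_spaceD[OF z(1) t] by (simp add: u_def)
  ultimately show False using \<open>\<psi> t > 0\<close> z(2) by simp
qed

lemma lie_center_iwasawa_n: "lie_center br (iwasawa_n br A P) = root_space br A \<psi>"
proof (intro equalityI subsetI)
  fix x assume x: "x \<in> root_space br A \<psi>"
  have "br x y = 0" if "y \<in> iwasawa_n br A P" for y
    using that unfolding iwasawa_n_def
  proof (induction rule: span_induct)
    case base
    show ?case by (auto simp: subspace_def br_simps)
  next
    case (step y)
    then obtain \<gamma> where \<gamma>: "\<gamma> \<in> P" "y \<in> root_space br A \<gamma>" by blast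
    show ?case
    proof (rule ccontr)
      assume "br x y \<noteq> 0"
      then have "\<psi> h0 + \<gamma> h0 \<le> \<psi> h0"
        by (rule weight_le(1)) (intro br_eigenvectors root_spaceD[OF x] root_spaceD[OF \<gamma>(2)])
      then show False using \<gamma>(1) P by simp
    qed
  qed
  moreover have "x \<in> iwasawa_n br A P"
    unfolding iwasawa_n_def using x \<psi>_in_P by (intro span_base) blast
  ultimately show "x \<in> lie_center br (iwasawa_n br A P)" by (simp add: lie_center_def)
next
  fix x assume "x \<in> lie_center br (iwasawa_n br A P)"
  then have x: "x \<in> span (\<Union>\<beta>\<in>P. root_space br A \<beta>)" "\<And>y. y \<in> iwasawa_n br A P \<Longrightarrow> br x y = 0"
    by (auto simp: lie_center_def iwasawa_n_def)
  obtain F c where F: "finite F" "F \<subseteq> P" "\<forall>\<beta>\<in>F. c \<beta> \<in> root_space br A \<beta> \<and> c \<beta> \<noteq> 0" "x = sum c F"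
    using in_span_Union_subspaces[OF x(1) root_space_subspace] by blast
  \<comment> \<open>The summands of \<open>br x y\<close> have distinct weights and are orthogonal
    for \<open>B\<close>, so they vanish one by one and each component of \<open>x\<close> is itself
    central.\<close>
  have "br (c \<beta>) y = 0" if "\<beta> \<in> F" and y: "\<gamma> \<in> P" "y \<in> root_space br A \<gamma>" for \<beta> \<gamma> y
  proof (rule orthogonal_sum_eq_0[of F "\<lambda>\<beta>. br (c \<beta>) y"])
    have "y \<in> iwasawa_n br A P" unfolding iwasawa_n_def using y by (intro span_base) blast
    then show "(\<Sum>\<beta>\<in>F. br (c \<beta>) y) = 0" using x(2) F(4) by (simp add: br_sum_left)
    show "B (br (c \<beta>) y) (br (c \<beta>') y) = 0" if \<beta>: "\<beta> \<in> F" "\<beta>' \<in> F" "\<beta> \<noteq> \<beta>'" for \<beta> \<beta>'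
    proof -
      have "\<beta> \<in> restricted_roots br A" "\<beta>' \<in> restricted_roots br A" using \<beta> F(2) P by auto
      then obtain h where h: "h \<in> A" "\<beta> h \<noteq> \<beta>' h" using root_eqI \<beta>(3) by blast
      have "br h (br (c \<delta>) y) = (\<delta> h + \<gamma> h) *\<^sub>R br (c \<delta>) y" if "\<delta> \<in> F" for \<delta>
        using F(3) that by (intro br_eigenvectors root_spaceD[OF _ h(1)] y(2)) blast
      then show ?thesis
        using eigenvectors_orthogonal[of "br h", OF B_br_p[OF A_p[OF h(1)]]] \<beta> h(2) by fastforce
    qed
  qed (use F(1) that(1) in auto)
  then have "\<beta> = \<psi>" if "\<beta> \<in> F" for \<beta>
    using central_root_vector[of \<beta> "c \<beta>"] that F(2,3) by blast
  then show "x \<in> root_space br A \<psi>"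
    unfolding F(4) using F(3) by (intro subspace_sum root_space_subspace) auto
qed

lemma dim_highest_root_space:
  assumes "e \<in> root_space br A \<psi>" "e \<noteq> 0"
  shows "dim (root_space br A \<psi>) = 1 \<longleftrightarrow> (\<forall>z\<in>root_space br A \<psi>. \<exists>r. z = r *\<^sub>R e)"
proof -
  have "dim (span {e}) = 1" using assms(2) by simp
  moreover have "span {e} \<subseteq> root_space br A \<psi>"
    using assms(1) by (intro span_minimal root_space_subspace) simp
  ultimately have "dim (root_space br A \<psi>) = 1 \<longleftrightarrow> span {e} = root_space br A \<psi>"
    using subspace_dim_equal[OF subspace_span root_space_subspace] by (metis order_refl)
  also have "\<dots> \<longleftrightarrow> (\<forall>z\<in>root_space br A \<psi>. \<exists>r. z = r *\<^sub>R e)"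
    using \<open>span {e} \<subseteq> root_space br A \<psi>\<close> by (auto simp: span_singleton image_iff)
  finally show ?thesis .
qed

lemma ad_square_rank_one_iff:
  assumes e: "e \<in> root_space br A \<psi>" "e \<noteq> 0"
  shows "(\<forall>y. \<exists>r. br e (br e y) = r *\<^sub>R e) \<longleftrightarrow> dim (root_space br A \<psi>) = 1"
proof
  assume "dim (root_space br A \<psi>) = 1"
  then show "\<forall>y. \<exists>r. br e (br e y) = r *\<^sub>R e"
    using dim_highest_root_space[OF e] ad_square_highest[OF e(1)] by blast
next
  assume rank_one: "\<forall>y. \<exists>r. br e (br e y) = r *\<^sub>R e"
  define k where "k = \<psi> (mu e)"
  have k: "k > 0" unfolding k_def using root_mu_pos[OF e] \<psi>_h0 by simp
  have mu_root: "br (mu e) z = k *\<^sub>R z" if "z \<in> root_space br A \<psi>" for z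
    unfolding k_def by (rule root_spaceD[OF that mu_in_A[OF e(1)]])
  have "\<exists>r. z = r *\<^sub>R e" if z: "z \<in> root_space br A \<psi>" for z
  proof -
    \<comment> \<open>Transported by \<theta>, the hypothesis says that the square of ad (\<theta>
      e) sends \<open>z\<close> into the line of \<open>\<theta> e\<close>; removing a multiple of
      \<open>e\<close> makes the image 0.\<close>
    obtain r where "br e (br e (\<theta> z)) = r *\<^sub>R e" using rank_one by blast
    then have "\<theta> (br e (br e (\<theta> z))) = \<theta> (r *\<^sub>R e)" by simp
    then have r: "br (\<theta> e) (br (\<theta> e) z) = r *\<^sub>R \<theta> e" by (simp add: \<theta>_simps)
    have "br (\<theta> e) e = mu e" using br_skew[of "\<theta> e" e] by (simp add: mu_def)
    then have "br (\<theta> e) (br (\<theta> e) e) = k *\<^sub>R \<theta> e"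
      using \<theta>_eigenvector[OF \<theta>_mu mu_root[OF e(1)]] br_skew[of "\<theta> e" "mu e"] by simp
    then have "br (\<theta> e) (br (\<theta> e) (z - (r / k) *\<^sub>R e)) = 0" using k r by (simp add: br_simps)
    moreover have "z - (r / k) *\<^sub>R e \<in> root_space br A \<psi>"
      by (intro subspace_diff subspace_scale root_space_subspace z e(1))
    ultimately have "z - (r / k) *\<^sub>R e = 0"
      using weight_vector_eq_0[OF mu_root[OF e(1)] k] mu_root by blast
    then show ?thesis by auto
  qed
  then show "dim (root_space br A \<psi>) = 1" using dim_highest_root_space[OF e] by blast
qed

lemma no_complex_structure:
  assumes e: "e \<in> root_space br A \<psi>" "e \<noteq> 0" and dim: "dim (root_space br A \<psi>) = 1"
    and J: "\<And>x y. J (br x y) = br x (J y)" "\<And>x. J (J x) = - x"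
    and "linear J"
  shows False
proof -
  have "J e \<in> root_space br A \<psi>"
    using root_spaceD[OF e(1)] \<open>linear J\<close> by (auto simp: root_space_def linear_cmul J(1)[symmetric])
  then obtain r where "J e = r *\<^sub>R e" using dim_highest_root_space[OF e] dim by blast
  then have "- e = (r * r) *\<^sub>R e" using J(2)[of e] linear_cmul[OF \<open>linear J\<close>] by simp
  then have "(r * r + 1) *\<^sub>R e = - e + e" by (simp add: scaleR_add_left)
  then show False using e(2) by (simp add: add_nonneg_eq_0_iff)
qed

end

theorem theorem0p4:
  fixes br :: "'g::euclidean_space \<Rightarrow> 'g \<Rightarrow> 'g"
    and \<theta> :: "'g \<Rightarrow> 'g" and A :: "'g set"
    and P :: "('g \<Rightarrow> real) set" and \<psi> :: "'g \<Rightarrow> real"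
    and x\<psi> e :: 'g and c :: real
  assumes simple: "simple_lie_algebra (*\<^sub>R) br"
    and noncompact: "\<not> compact_lie_algebra br"
    and cartan: "cartan_involution br \<theta>"
    and max_abelian: "maximal_abelian_in br (cartan_p \<theta>) A"
    and positive: "positive_system br A P"
    and highest: "highest_root br A P \<psi>"
    and x\<psi>: "x\<psi> \<in> A" "\<forall>h\<in>A. \<psi> h = 0 \<longrightarrow> killing br x\<psi> h = 0" "\<psi> x\<psi> = 2"
    and form: "c > 0" "c * killing br x\<psi> x\<psi> = 2"
    and e: "e \<in> root_space br A \<psi>" "c * killing br e (\<theta> e) = - 1"
  shows "Omin_split br e \<longleftrightarrow> dim (lie_center br (iwasawa_n br A P)) = 1"
proof -
  obtain h0 where h0: "h0 \<in> A" "\<forall>\<beta>\<in>restricted_roots br A. \<beta> h0 \<noteq> 0"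
    "P = {\<beta> \<in> restricted_roots br A. \<beta> h0 > 0}"
    using positive by (auto simp: positive_system_def)
  interpret restricted_root_system br \<theta> A P \<psi> h0
    using simple cartan max_abelian highest h0
    by (intro restricted_root_system.intro restricted_root_system_axioms.intro cartan_lie_algebra.intro
        cartan_lie_algebra_axioms.intro real_lie_algebra.intro simple_lie_algebra.axioms(1)) auto
  have "e \<noteq> 0" using e(2) by (auto simp: killing_simps)
  note e = e(1) this
  \<comment> \<open>\<open>Omin_split\<close> contains simplicity, so it has to be proved only
    starting from the dimension.\<close>
  have "simple_lie_algebra cscale (complexify br)" if "dim (root_space br A \<psi>) = 1"
    using simple_complexify[OF simple] no_complex_structure[OF e that] by metis
  then show ?thesis
    unfolding Omin_split_def lie_center_iwasawa_n
    using O_min_complexify[of e] ad_square_rank_one_iff[OF e] e(2) by blast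
qed

end
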